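(* Let $D=[0,1]^m$ and let $k:D\times D\to\mathbb{R}$ be the neural network (arcsin) kernel $$k(x,y)=\frac{2\sigma_\varsigma^2}{\pi}\arcsin\left(\frac{\sigma_v^2\langle x,y\rangle+\sigma_b^2}{\sqrt{(1+\sigma_v^2\langle x,x\rangle+\sigma_b^2)(1+\sigma_v^2\langle y,y\rangle+\sigma_b^2)}}\right),$$ with hyperparameters $\sigma_\varsigma,\sigma_v,\sigma_b>0$. Then the eigenvalues $\lambda_s$ of the integral operator of $k$ decay exponentially. Consequently, the eigenvalue tail sum $B_k(T_* )=\sum_{s=T_*+1}^\infty\lambda_s$ is bounded as $$B_k(T_* )\le\mathcal{O}\left(\exp\left(-\beta T_*^{1/m}\right)\right)$$ for some constant $\beta>0$.
   Context: Here $m$ is a positive integer (the dimension of the contract space $[0,1]^m$). The integral operator of $k$ is $f\mapsto\int_Dk(\cdot,y)f(y)\,dy$ on $L^2(D)$ with respect to the uniform distribution on $D=[0,1]^m$; its eigenvalues $\lambda_1\ge\lambda_2\ge\cdots\ge0$ are listed in non-increasing order with multiplicity. $\mathcal{O}(\cdot)$ is as $T_*\to\infty$ over positive integers. *)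

theory Defs
  imports "HOL-Analysis.Analysis" "HOL-Library.Landau_Symbols"
begin

definition nn_kernel :: "real \<Rightarrow> real \<Rightarrow> real \<Rightarrow> 'a::real_inner \<Rightarrow> 'a \<Rightarrow> real" where
  "nn_kernel \<sigma>s \<sigma>v \<sigma>b x y =
     2 * \<sigma>s\<^sup>2 / pi *
     arcsin ((\<sigma>v\<^sup>2 * (x \<bullet> y) + \<sigma>b\<^sup>2) /
       sqrt ((1 + \<sigma>v\<^sup>2 * (x \<bullet> x) + \<sigma>b\<^sup>2) * (1 + \<sigma>v\<^sup>2 * (y \<bullet> y) + \<sigma>b\<^sup>2)))"

definition unit_cube :: "(real ^ 'm) set" where
  "unit_cube = {x. \<forall>i. 0 \<le> x $ i \<and> x $ i \<le> 1}"

text \<open>Elements of \<open>L\<^sup>2(M)\<close> are represented by functions; identification of functions that agree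
  almost everywhere is made explicit wherever it matters.\<close>

definition L2_fun :: "'a measure \<Rightarrow> ('a \<Rightarrow> real) \<Rightarrow> bool" where
  "L2_fun M f \<longleftrightarrow> f \<in> borel_measurable M \<and> integrable M (\<lambda>x. (f x)\<^sup>2)"

definition integral_operator ::
    "'a measure \<Rightarrow> ('a \<Rightarrow> 'a \<Rightarrow> real) \<Rightarrow> ('a \<Rightarrow> real) \<Rightarrow> 'a \<Rightarrow> real" where
  "integral_operator M k f x = (\<integral>y. k x y * f y \<partial>M)"

definition eigenspace ::
    "'a measure \<Rightarrow> ('a \<Rightarrow> 'a \<Rightarrow> real) \<Rightarrow> real \<Rightarrow> ('a \<Rightarrow> real) set" where
  "eigenspace M k \<mu> = {f. L2_fun M f \<and> (AE x in M. integral_operator M k f x = \<mu> * f x)}"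

text \<open>\<open>V\<close> has finite dimension \<open>n\<close> modulo almost everywhere equality: it has a basis
  \<open>f 0, \<dots>, f (n - 1)\<close>.\<close>

definition has_dim_AE :: "'a measure \<Rightarrow> ('a \<Rightarrow> real) set \<Rightarrow> nat \<Rightarrow> bool" where
  "has_dim_AE M V n \<longleftrightarrow> (\<exists>f :: nat \<Rightarrow> 'a \<Rightarrow> real.
     (\<forall>i<n. f i \<in> V) \<and>
     (\<forall>c. (AE x in M. (\<Sum>i<n. c i * f i x) = 0) \<longrightarrow> (\<forall>i<n. c i = 0)) \<and>
     (\<forall>g\<in>V. \<exists>c. AE x in M. g x = (\<Sum>i<n. c i * f i x)))"

text \<open>\<open>lam 1 \<ge> lam 2 \<ge> \<dots> \<ge> 0\<close> lists the eigenvalues with multiplicity (the value \<open>lam 0\<close> is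
  irrelevant). Every nonzero eigenvalue occurs exactly as often as the dimension of its eigenspace,
  and no other nonzero number occurs; in particular there is no negative eigenvalue. If there are
  only finitely many positive eigenvalues, the list is continued by zeros. These conditions
  determine \<open>lam s\<close> for all \<open>s \<ge> 1\<close>.\<close>

definition eigenvalue_listing ::
    "'a measure \<Rightarrow> ('a \<Rightarrow> 'a \<Rightarrow> real) \<Rightarrow> (nat \<Rightarrow> real) \<Rightarrow> bool" where
  "eigenvalue_listing M k lam \<longleftrightarrow>
     (\<forall>s\<ge>1. lam (Suc s) \<le> lam s \<and> 0 \<le> lam s) \<and>
     (\<forall>\<mu>. \<mu> \<noteq> 0 \<longrightarrow>
        finite {s. 1 \<le> s \<and> lam s = \<mu>} \<and>
        has_dim_AE M (eigenspace M k \<mu>) (card {s. 1 \<le> s \<and> lam s = \<mu>}))"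

definition eigenvalue_tail_sum :: "(nat \<Rightarrow> real) \<Rightarrow> nat \<Rightarrow> real" where
  "eigenvalue_tail_sum lam T = (\<Sum>\<^sub>\<infinity>s\<in>{T+1..}. lam s)"

end

theory Submission
  imports Defs "HOL-Complex_Analysis.Great_Picard" "HOL-Probability.Probability_Measure"
    "HOL-Real_Asymp.Real_Asymp"
begin

text \<open>Existence of the listing is the spectral theorem for a continuous positive semidefinite kernel:
  a maximiser of the Rayleigh quotient is split off repeatedly.

  For the decay, put \<open>w x = sqrt (1 + \<sigma>v\<^sup>2 (x \<bullet> x) + \<sigma>b\<^sup>2)\<close>. The argument of the arcsine is the inner
  product of \<open>(\<sigma>b, \<sigma>v x) / w x\<close> and \<open>(\<sigma>b, \<sigma>v y) / w y\<close> and bounded by some \<open>p < 1\<close> in modulus on the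
  cube. Since arcsine has nonnegative Taylor coefficients, the kernel is positive semidefinite, and
  truncating the series at degree \<open>n\<close> costs \<open>O(q^n)\<close>. The set of vectors \<open>(\<sigma>b, \<sigma>v x) / w x\<close> lies on a
  quadric in \<open>m + 1\<close> dimensions, so the truncated kernel has rank \<open>O(n^m)\<close> and not only \<open>O(n^(m+1))\<close>.
  An eigenvalue beyond the rank of the truncation is at most the truncation error.\<close>

section \<open>Integral operators with continuous kernels\<close>

text \<open>The eigenspaces in the statement live in L2, but an eigenfunction for a value
  \<open>\<mu>\<close> other than 0 agrees almost everywhere with \<open>op K f / \<mu>\<close>,
  which is continuous. Hence the whole argument runs with continuous functions and the inner product
  \<open>ip\<close>. The role of completeness of the eigenfunctions is taken by an inequality: once
  \<open>n\<close> eigenpairs are split off, the remaining quadratic form is at most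
  \<open>\<mu> n\<close> times the squared norm. This captures whole eigenspaces only if the
  extracted values tend to 0, and that follows from the rank bound that also gives the decay.
  Truncation is thus used twice, for existence and for the rate. The rate: an error of order
  \<open>q ^ n\<close> is reached at rank \<open>2 * (2 * n + 1) ^ m\<close>. Solving for
  \<open>n\<close> at a given position \<open>s\<close> makes \<open>n\<close> proportional to the
  m-th root of \<open>s\<close>.\<close>

locale compact_prob = prob_space M for M :: "'a::euclidean_space measure" +
  fixes D :: "'a set"
  assumes compact_D: "compact D"
    and sets_M [measurable_cong]: "sets M = sets borel"
    and AE_D: "AE x in M. x \<in> D"
begin

abbreviation op :: "('a \<Rightarrow> 'a \<Rightarrow> real) \<Rightarrow> ('a \<Rightarrow> real) \<Rightarrow> 'a \<Rightarrow> real" where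
  "op \<equiv> integral_operator M"

definition ip :: "('a \<Rightarrow> real) \<Rightarrow> ('a \<Rightarrow> real) \<Rightarrow> real" where
  "ip f g = (\<integral>x. f x * g x \<partial>M)"

definition continuous_kernel :: "('a \<Rightarrow> 'a \<Rightarrow> real) \<Rightarrow> bool" where
  "continuous_kernel K \<longleftrightarrow> continuous_on UNIV (\<lambda>p. K (fst p) (snd p))"

lemma D_nonempty: "D \<noteq> {}"
proof
  assume "D = {}"
  then have "AE x in M. False" using AE_D by simp
  then show False by simp
qed

section \<open>Integrability of continuous functions and kernels over a compact carrier\<close>

lemma continuous_measurable: "continuous_on UNIV f \<Longrightarrow> f \<in> borel_measurable M"
  for f :: "'a \<Rightarrow> real"
  by (simp add: borel_measurable_continuous_onI cong: measurable_cong_sets[OF sets_M refl])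

lemma bounded_integrable:
  fixes f :: "'a \<Rightarrow> real"
  assumes "f \<in> borel_measurable M" "\<And>x. x \<in> D \<Longrightarrow> \<bar>f x\<bar> \<le> B"
  shows "integrable M f"
  by (rule integrable_const_bound[where B = B]) (use assms AE_D in \<open>auto elim: AE_mp\<close>)

lemma continuous_bounded_on_D:
  fixes f :: "'a \<Rightarrow> real"
  assumes "continuous_on UNIV f"
  obtains B where "B > 0" "\<And>x. x \<in> D \<Longrightarrow> \<bar>f x\<bar> \<le> B"
proof -
  have "bounded (f ` D)"
    using compact_D assms
    by (meson compact_continuous_image compact_imp_bounded continuous_on_subset subset_UNIV)
  then show ?thesis using that by (auto simp: bounded_pos)
qed

lemma continuous_integrable:
  fixes f :: "'a \<Rightarrow> real"
  assumes "continuous_on UNIV f"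
  shows "integrable M f"
  using continuous_bounded_on_D[OF assms] bounded_integrable continuous_measurable[OF assms]
  by metis

lemma kernel_section_continuous:
  assumes "continuous_kernel K"
  shows "continuous_on UNIV (K x)" "continuous_on UNIV (\<lambda>x. K x y)"
proof -
  have *: "continuous_on UNIV (\<lambda>p. K (fst p) (snd p))"
    using assms by (simp add: continuous_kernel_def)
  show "continuous_on UNIV (K x)"
    using continuous_on_compose2[OF *, of UNIV "\<lambda>y. (x, y)"] by (simp add: continuous_intros)
  show "continuous_on UNIV (\<lambda>x. K x y)"
    using continuous_on_compose2[OF *, of UNIV "\<lambda>x. (x, y)"] by (simp add: continuous_intros)
qed

text \<open>The first variable has its own compact set, since bounds are needed at arbitrary single
  points as well as on \<open>D\<close>; the integration variable can always be kept in
  \<open>D\<close>.\<close>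

lemma kernel_bounded:
  assumes "continuous_kernel K" "compact S"
  obtains B where "B > 0" "\<And>x y. x \<in> S \<Longrightarrow> y \<in> D \<Longrightarrow> \<bar>K x y\<bar> \<le> B"
proof -
  have "bounded ((\<lambda>p. K (fst p) (snd p)) ` (S \<times> D))"
    using assms compact_Times[OF assms(2) compact_D] unfolding continuous_kernel_def
    by (meson compact_continuous_image compact_imp_bounded continuous_on_subset subset_UNIV)
  then obtain B where "B > 0" "\<forall>z\<in>(\<lambda>p. K (fst p) (snd p)) ` (S \<times> D). norm z \<le> B"
    unfolding bounded_pos by blast
  then show ?thesis using that[of B] by force
qed

lemma kernel_integrable:
  assumes "continuous_kernel K" "integrable M f"
  shows "integrable M (\<lambda>y. K x y * f y)"
proof -
  obtain B where B: "B > 0" "\<And>y. y \<in> D \<Longrightarrow> \<bar>K x y\<bar> \<le> B"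
    by (metis kernel_bounded[OF assms(1) compact_sing] singletonI)
  have [measurable]: "K x \<in> borel_measurable M" "f \<in> borel_measurable M"
    using continuous_measurable kernel_section_continuous assms by auto
  show ?thesis
  proof (rule Bochner_Integration.integrable_bound)
    show "integrable M (\<lambda>y. B * f y)" using assms by simp
    show "AE y in M. norm (K x y * f y) \<le> norm (B * f y)"
      using AE_D by eventually_elim (use B in \<open>auto simp: abs_mult intro!: mult_right_mono\<close>)
  qed simp
qed

text \<open>Kernels and evaluation points vary together so that one estimate serves three ends:
  \<open>K = L\<close> gives equicontinuity of \<open>op K f\<close>, equal points give the effect
  of perturbing the kernel, and \<open>L = 0\<close> gives a sup bound. Only the L1 norm of
  \<open>f\<close> enters.\<close>

lemma op_diff_le:
  assumes K: "continuous_kernel K" "continuous_kernel L" and f: "integrable M f"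
    and le: "\<And>y. y \<in> D \<Longrightarrow> \<bar>K x y - L x' y\<bar> \<le> \<delta>"
  shows "\<bar>op K f x - op L f x'\<bar> \<le> \<delta> * (\<integral>y. \<bar>f y\<bar> \<partial>M)"
proof -
  have i: "integrable M (\<lambda>y. K x y * f y)" "integrable M (\<lambda>y. L x' y * f y)"
    using kernel_integrable assms by auto
  have "op K f x - op L f x' = (\<integral>y. K x y * f y - L x' y * f y \<partial>M)"
    unfolding integral_operator_def using i by simp
  also have "\<bar>\<dots>\<bar> \<le> (\<integral>y. \<bar>K x y * f y - L x' y * f y\<bar> \<partial>M)"
    by (rule integral_abs_bound)
  also have "\<dots> \<le> (\<integral>y. \<delta> * \<bar>f y\<bar> \<partial>M)"
  proof (rule integral_mono_AE)
    show "AE y in M. \<bar>K x y * f y - L x' y * f y\<bar> \<le> \<delta> * \<bar>f y\<bar>"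
      using AE_D
      by eventually_elim (use le in \<open>auto simp: abs_mult left_diff_distrib[symmetric] intro!: mult_right_mono\<close>)
  qed (use i f in auto)
  finally show ?thesis by simp
qed

lemma op_abs_le:
  assumes K: "continuous_kernel K" and f: "integrable M f"
    and le: "\<And>y. y \<in> D \<Longrightarrow> \<bar>K x y\<bar> \<le> B"
  shows "\<bar>op K f x\<bar> \<le> B * (\<integral>y. \<bar>f y\<bar> \<partial>M)"
proof -
  have "continuous_kernel (\<lambda>x y. 0)" by (simp add: continuous_kernel_def)
  from op_diff_le[OF K this f, where x = x and x' = x and \<delta> = B] le show ?thesis
    by (simp add: integral_operator_def)
qed

lemma kernel_equicontinuous:
  assumes "continuous_kernel K" "compact S" "\<epsilon> > 0"
  obtains d where "d > 0"
    "\<And>x x' y. x \<in> S \<Longrightarrow> x' \<in> S \<Longrightarrow> dist x x' < d \<Longrightarrow> y \<in> D \<Longrightarrow> \<bar>K x y - K x' y\<bar> \<le> \<epsilon>"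
proof -
  have "uniformly_continuous_on (S \<times> D) (\<lambda>p. K (fst p) (snd p))"
    using assms compact_Times[OF assms(2) compact_D] unfolding continuous_kernel_def
    by (meson compact_uniformly_continuous continuous_on_subset subset_UNIV)
  then obtain d where d: "d > 0"
    "\<forall>p\<in>S \<times> D. \<forall>p'\<in>S \<times> D. dist p' p < d \<longrightarrow> dist (K (fst p') (snd p')) (K (fst p) (snd p)) < \<epsilon>"
    unfolding uniformly_continuous_on_def using assms(3) by blast
  show ?thesis
  proof (rule that[OF d(1)])
    fix x x' y assume "x \<in> S" "x' \<in> S" "dist x x' < d" "y \<in> D"
    then have "dist (K x y) (K x' y) < \<epsilon>"
      using d(2)[rule_format, of "(x',y)" "(x,y)"] by (simp add: dist_Pair_Pair)
    then show "\<bar>K x y - K x' y\<bar> \<le> \<epsilon>" by (simp add: dist_real_def)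
  qed
qed

lemma op_continuous:
  assumes "continuous_kernel K" "integrable M f"
  shows "continuous_on UNIV (op K f)"
proof -
  have "isCont (op K f) x" for x
    unfolding continuous_at_eps_delta
  proof (intro allI impI)
    fix e :: real assume e: "e > 0"
    define F where "F = (\<integral>y. \<bar>f y\<bar> \<partial>M)"
    have F: "F \<ge> 0" by (simp add: F_def)
    \<comment> \<open>The \<open>+ 1\<close> keeps the quotient meaningful for \<open>F = 0\<close>
      and the final bound strict; the unit ball is the compact neighbourhood of
      \<open>x\<close>.\<close>
    obtain d where d: "d > 0"
      "\<And>u u' y. u \<in> cball x 1 \<Longrightarrow> u' \<in> cball x 1 \<Longrightarrow> dist u u' < d \<Longrightarrow> y \<in> D \<Longrightarrow>
          \<bar>K u y - K u' y\<bar> \<le> e / (F + 1)"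
      using kernel_equicontinuous[OF assms(1) compact_cball, of "e / (F + 1)"] e F by auto
    have "dist (op K f x') (op K f x) < e" if "dist x' x < min d 1" for x'
    proof -
      have "\<bar>op K f x' - op K f x\<bar> \<le> e / (F + 1) * F"
        unfolding F_def using that
        by (intro op_diff_le assms d(2)[unfolded F_def]) (auto simp: dist_commute)
      also have "\<dots> < e" using e F by (simp add: field_simps)
      finally show ?thesis by (simp add: dist_real_def)
    qed
    then show "\<exists>d>0. \<forall>x'. dist x' x < d \<longrightarrow> dist (op K f x') (op K f x) < e"
      using d(1) by (intro exI[of _ "min d 1"]) auto
  qed
  then show ?thesis by (simp add: continuous_on_eq_continuous_at)
qed

text \<open>Prepares Fubini: the product of the two Borel algebras is the Borel algebra of the
  product space, so a continuous kernel is measurable for it, and it is bounded where both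
  coordinates lie in \<open>D\<close>.\<close>

lemma double_integrable:
  assumes "continuous_kernel K"
  shows "integrable (M \<Otimes>\<^sub>M M) (case_prod K)"
proof -
  interpret pair_prob_space M M ..
  obtain B where B: "\<And>x y. x \<in> D \<Longrightarrow> y \<in> D \<Longrightarrow> \<bar>K x y\<bar> \<le> B"
    using kernel_bounded[OF assms compact_D] by metis
  have s: "sets (M \<Otimes>\<^sub>M M) = sets borel"
    unfolding borel_prod[symmetric] by (rule sets_pair_measure_cong[OF sets_M sets_M])
  have c: "case_prod K = (\<lambda>p. K (fst p) (snd p))" by auto
  have m [measurable]: "case_prod K \<in> borel_measurable (M \<Otimes>\<^sub>M M)"
    using assms unfolding c continuous_kernel_def
    by (simp add: borel_measurable_continuous_onI cong: measurable_cong_sets[OF s refl])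
  have "AE p in M \<Otimes>\<^sub>M M. \<bar>case_prod K p\<bar> \<le> B"
  proof (rule AE_pair_measure)
    show "AE x in M. AE y in M. \<bar>case_prod K (x, y)\<bar> \<le> B"
      using AE_D
    proof eventually_elim
      case (elim x)
      show ?case using AE_D by eventually_elim (use B elim in auto)
    qed
  qed measurable
  then show ?thesis by (intro integrable_const_bound[where B = B]) auto
qed

section \<open>The inner product on continuous functions, self-adjointness and norm
  estimates\<close>

lemma op_selfadjoint:
  assumes K: "continuous_kernel K" and sym: "\<And>x y. K x y = K y x"
    and f: "continuous_on UNIV f" and g: "continuous_on UNIV g"
  shows "ip f (op K g) = ip (op K f) g"
proof -
  interpret pair_prob_space M M ..
  have "continuous_on UNIV (\<lambda>p. f (fst p) * K (fst p) (snd p) * g (snd p))"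
    using K unfolding continuous_kernel_def
    by (intro continuous_intros continuous_on_compose2[OF f] continuous_on_compose2[OF g]) auto
  then have i: "integrable (M \<Otimes>\<^sub>M M) (case_prod (\<lambda>x y. f x * K x y * g y))"
    by (intro double_integrable) (simp add: continuous_kernel_def)
  have swap: "f x * K x y * g y = K y x * f x * g y" for x y using sym[of x y] by simp
  have "ip f (op K g) = (\<integral>x. (\<integral>y. f x * K x y * g y \<partial>M) \<partial>M)"
    by (simp add: ip_def integral_operator_def mult.assoc)
  also have "\<dots> = (\<integral>y. (\<integral>x. f x * K x y * g y \<partial>M) \<partial>M)"
    using Fubini_integral[OF i] by simp
  also have "\<dots> = ip (op K f) g"
    unfolding ip_def integral_operator_def by (simp add: swap)
  finally show ?thesis .
qed

lemma ip_commute: "ip f g = ip g f"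
  by (simp add: ip_def mult.commute)

lemma
  assumes "continuous_on UNIV f" "continuous_on UNIV g" "continuous_on UNIV h"
  shows ip_diff_left: "ip (\<lambda>x. f x - g x) h = ip f h - ip g h"
    and ip_diff_right: "ip h (\<lambda>x. f x - g x) = ip h f - ip h g"
  using assms
  by (simp_all add: ip_def ring_distribs continuous_integrable continuous_on_mult)

lemma ip_scale_left: "ip (\<lambda>x. c * f x) g = c * ip f g"
  and ip_scale_right: "ip f (\<lambda>x. c * g x) = c * ip f g"
  by (simp_all add: ip_def mult_ac)

lemma ip_sum_left:
  assumes "\<And>i. i \<in> I \<Longrightarrow> continuous_on UNIV (f i)" "continuous_on UNIV g"
  shows "ip (\<lambda>x. \<Sum>i\<in>I. f i x) g = (\<Sum>i\<in>I. ip (f i) g)"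
  using assms
  by (simp add: ip_def sum_distrib_right continuous_integrable continuous_on_mult Bochner_Integration.integral_sum)

lemma ip_sum_right:
  assumes "\<And>i. i \<in> I \<Longrightarrow> continuous_on UNIV (f i)" "continuous_on UNIV g"
  shows "ip g (\<lambda>x. \<Sum>i\<in>I. f i x) = (\<Sum>i\<in>I. ip g (f i))"
  using ip_sum_left[OF assms] by (simp add: ip_commute[of g])

lemma ip_nonneg: "ip f f \<ge> 0"
  by (simp add: ip_def)

lemma ip_eq_0_iff:
  assumes "continuous_on UNIV f"
  shows "ip f f = 0 \<longleftrightarrow> (AE x in M. f x = 0)"
proof -
  have "integrable M (\<lambda>x. f x * f x)" using assms by (simp add: continuous_integrable continuous_on_mult)
  then show ?thesis unfolding ip_def by (subst integral_nonneg_eq_0_iff_AE) auto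
qed

lemma ip_cong_AE:
  assumes "continuous_on UNIV f" "continuous_on UNIV f'" "continuous_on UNIV g"
    and "AE x in M. f x = f' x"
  shows "ip f g = ip f' g"
  unfolding ip_def using assms
  by (intro integral_cong_AE) (auto intro!: continuous_measurable continuous_on_mult elim: AE_mp)

text \<open>Cauchy-Schwarz against the constant 1 on a probability space, read off from the
  nonnegative variance of the absolute value.\<close>

lemma integral_abs_le:
  assumes "continuous_on UNIV f"
  shows "(\<integral>x. \<bar>f x\<bar> \<partial>M) \<le> sqrt (ip f f)"
proof -
  define a where "a = (\<integral>x. \<bar>f x\<bar> \<partial>M)"
  have i: "integrable M (\<lambda>x. \<bar>f x\<bar>)" "integrable M (\<lambda>x. f x * f x)"
    using assms by (simp_all add: continuous_integrable continuous_on_mult)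
  have "0 \<le> (\<integral>x. (\<bar>f x\<bar> - a)\<^sup>2 \<partial>M)" by simp
  also have "\<dots> = (\<integral>x. f x * f x - 2 * a * \<bar>f x\<bar> + a\<^sup>2 \<partial>M)"
    by (intro Bochner_Integration.integral_cong) (auto simp: power2_eq_square algebra_simps)
  also have "\<dots> = ip f f - 2 * a * a + a\<^sup>2"
    using i by (simp add: ip_def a_def prob_space)
  finally have "a\<^sup>2 \<le> ip f f" by (simp add: power2_eq_square)
  then show ?thesis unfolding a_def[symmetric] by (rule real_le_rsqrt)
qed

text \<open>The forms differ by at most \<open>\<delta>\<close> times the squared L1 norm, which the
  squared L2 norm dominates as the total mass is 1. This bounds the Rayleigh quotient, carries
  positivity from truncations to the limit, and compares a kernel with one of finite rank.\<close>

lemma qform_diff_le: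
  assumes K: "continuous_kernel K" "continuous_kernel L" and f: "continuous_on UNIV f"
    and le: "\<And>x y. x \<in> D \<Longrightarrow> y \<in> D \<Longrightarrow> \<bar>K x y - L x y\<bar> \<le> \<delta>"
  shows "\<bar>ip f (op K f) - ip f (op L f)\<bar> \<le> \<delta> * ip f f"
proof -
  define F where "F = (\<integral>y. \<bar>f y\<bar> \<partial>M)"
  have F: "F \<ge> 0" by (simp add: F_def)
  have \<delta>: "\<delta> \<ge> 0" using D_nonempty le by force
  note fi = continuous_integrable[OF f]
  note c = op_continuous[OF K(1) fi] op_continuous[OF K(2) fi]
  have i: "integrable M (\<lambda>x. f x * op K f x)" "integrable M (\<lambda>x. f x * op L f x)"
    using f c by (simp_all add: continuous_integrable continuous_on_mult)
  have "\<bar>ip f (op K f) - ip f (op L f)\<bar> = \<bar>\<integral>x. f x * op K f x - f x * op L f x \<partial>M\<bar>"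
    using i by (simp add: ip_def)
  also have "\<dots> \<le> (\<integral>x. \<bar>f x * op K f x - f x * op L f x\<bar> \<partial>M)"
    by (rule integral_abs_bound)
  also have "\<dots> \<le> (\<integral>x. \<bar>f x\<bar> * (\<delta> * F) \<partial>M)"
  proof (rule integral_mono_AE)
    show "AE x in M. \<bar>f x * op K f x - f x * op L f x\<bar> \<le> \<bar>f x\<bar> * (\<delta> * F)"
      using AE_D
    proof eventually_elim
      case (elim x)
      have "\<bar>op K f x - op L f x\<bar> \<le> \<delta> * F"
        unfolding F_def using K fi le[OF elim] by (rule op_diff_le)
      then show ?case by (simp add: abs_mult right_diff_distrib[symmetric] mult_left_mono)
    qed
  qed (use i fi in auto)
  also have "\<dots> = \<delta> * F\<^sup>2" by (simp add: F_def power2_eq_square)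
  also have "\<dots> \<le> \<delta> * ip f f"
    using \<delta> integral_abs_le[OF f] F ip_nonneg[of f]
    by (intro mult_left_mono) (auto simp: F_def[symmetric] sqrt_le_D real_le_lsqrt
        dest: power_mono[of F _ 2])
  finally show ?thesis .
qed

lemma op_diff:
  assumes "continuous_kernel K" "integrable M f" "integrable M g"
  shows "op K (\<lambda>x. f x - g x) x = op K f x - op K g x"
  using kernel_integrable assms by (simp add: integral_operator_def ring_distribs)

lemma op_scale: "op K (\<lambda>x. c * f x) x = c * op K f x"
  by (simp add: integral_operator_def mult_ac)

lemma op_sum:
  assumes "continuous_kernel K" "\<And>i. i \<in> I \<Longrightarrow> integrable M (f i)"
  shows "op K (\<lambda>x. \<Sum>i\<in>I. f i x) x = (\<Sum>i\<in>I. op K (f i) x)"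
  using kernel_integrable assms
  by (simp add: integral_operator_def sum_distrib_left Bochner_Integration.integral_sum)

text \<open>The equality holds at every \<open>x\<close>, because only the integrand changes on a
  null set. Eigenvalue equations of continuous functions thereby become pointwise
  identities.\<close>

lemma op_cong_AE:
  assumes "continuous_kernel K" "f \<in> borel_measurable M" "g \<in> borel_measurable M" "AE x in M. f x = g x"
  shows "op K f x = op K g x"
  unfolding integral_operator_def using assms continuous_measurable[OF kernel_section_continuous(1)]
  by (intro integral_cong_AE) (auto intro!: borel_measurable_times elim: AE_mp)

text \<open>Positivity is asked of the quadratic form on continuous functions, not of Gram matrices
  of finite point sets: this is the form that splitting off an eigenpair preserves.\<close>

definition psd_kernel :: "('a \<Rightarrow> 'a \<Rightarrow> real) \<Rightarrow> bool" where
  "psd_kernel K \<longleftrightarrow> continuous_kernel K \<and> (\<forall>x y. K x y = K y x) \<and>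
     (\<forall>f. continuous_on UNIV f \<longrightarrow> 0 \<le> ip f (op K f))"

section \<open>Uniform limits and the largest eigenvalue\<close>

lemma op_LIMSEQ_uniform:
  assumes K: "continuous_kernel K"
    and h: "\<And>n. continuous_on UNIV (h n)" "g \<in> borel_measurable M" "integrable M g"
    and lim: "\<And>e. e > 0 \<Longrightarrow> \<exists>N. \<forall>n x. n \<ge> N \<and> x \<in> D \<longrightarrow> norm (h n x - g x) < e"
  shows "(\<lambda>n. op K (h n) x) \<longlonglongrightarrow> op K g x"
proof -
  obtain B where B: "B > 0" "\<And>y. y \<in> D \<Longrightarrow> \<bar>K x y\<bar> \<le> B"
    by (metis kernel_bounded[OF K compact_sing] singletonI)
  show ?thesis
  proof (rule LIMSEQ_I)
    fix e :: real assume e: "e > 0"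
    then obtain N where N: "\<And>n x. n \<ge> N \<Longrightarrow> x \<in> D \<Longrightarrow> \<bar>h n x - g x\<bar> < e / (2 * B)"
      using lim[of "e / (2 * B)"] B(1) by auto
    have "norm (op K (h n) x - op K g x) < e" if n: "n \<ge> N" for n
    proof -
      have i: "integrable M (\<lambda>y. h n y - g y)" "integrable M (\<lambda>y. \<bar>h n y - g y\<bar>)"
        using h continuous_integrable by auto
      have "op K (h n) x - op K g x = op K (\<lambda>y. h n y - g y) x"
        by (simp add: op_diff[OF K] continuous_integrable h)
      also have "\<bar>\<dots>\<bar> \<le> B * (\<integral>y. \<bar>h n y - g y\<bar> \<partial>M)"
        using K i(1) B(2) by (rule op_abs_le)
      also have "\<dots> \<le> B * (\<integral>y. e / (2 * B) \<partial>M)"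
      proof (intro mult_left_mono integral_mono_AE)
        show "AE y in M. \<bar>h n y - g y\<bar> \<le> e / (2 * B)"
          using AE_D by eventually_elim (use N n in \<open>auto intro: less_imp_le\<close>)
      qed (use i B in auto)
      also have "\<dots> < e" using B e by (simp add: prob_space)
      finally show ?thesis by simp
    qed
    then show "\<exists>N. \<forall>n\<ge>N. norm (op K (h n) x - op K g x) < e" by blast
  qed
qed

text \<open>The operator inequality \<open>K^2 <= \<mu> K\<close> for
  \<open>0 <= K <= \<mu>\<close>, obtained by testing positivity at \<open>f - t K f\<close>. It
  trades the squared norm of \<open>op K f\<close> for the Rayleigh quotient, which makes a
  maximising sequence an approximate eigenvector.\<close>

lemma psd_kernel_op_norm_le:
  assumes K: "psd_kernel K" and f: "continuous_on UNIV f" and "\<mu> > 0"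
    and le: "\<And>f. continuous_on UNIV f \<Longrightarrow> ip f (op K f) \<le> \<mu> * ip f f"
  shows "ip (op K f) (op K f) \<le> \<mu> * ip f (op K f)"
proof -
  have ck: "continuous_kernel K" and sym: "\<And>x y. K x y = K y x"
    and pos: "\<And>f. continuous_on UNIV f \<Longrightarrow> 0 \<le> ip f (op K f)"
    using K by (auto simp: psd_kernel_def)
  define g where "g = op K f"
  have g: "continuous_on UNIV g" "continuous_on UNIV (op K g)"
    unfolding g_def using f by (auto intro!: op_continuous ck continuous_integrable)
  note i = continuous_integrable[OF f] continuous_integrable[OF g(1)]
  \<comment> \<open>This value minimises \<open>t\<^sup>2 * \<mu> - 2 * t\<close>, the coefficient
    of \<open>ip g g\<close> once the form at \<open>g\<close> is estimated by
    \<open>\<mu> * ip g g\<close>.\<close>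
  define t where "t = 1 / \<mu>"
  have t: "t > 0" "t * \<mu> = 1" using \<open>\<mu> > 0\<close> by (auto simp: t_def)
  have c: "continuous_on UNIV (\<lambda>x. t * g x)" "continuous_on UNIV (\<lambda>x. t * op K g x)"
    using g by (auto intro: continuous_intros)
  have op: "op K (\<lambda>x. f x - t * g x) = (\<lambda>x. g x - t * op K g x)"
    using op_diff[OF ck i(1) continuous_integrable[OF c(1)]] by (simp add: fun_eq_iff op_scale flip: g_def)
  have fg: "ip f (op K g) = ip g g" unfolding op_selfadjoint[OF ck sym f g(1)] by (simp add: g_def)
  have "0 \<le> ip (\<lambda>x. f x - t * g x) (op K (\<lambda>x. f x - t * g x))"
    using f g by (intro pos continuous_intros) auto
  also have "\<dots> = ip f g - 2 * t * ip g g + t\<^sup>2 * ip g (op K g)"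
    unfolding op
    by (simp add: f g c ip_diff_left ip_diff_right ip_scale_left ip_scale_right fg continuous_on_diff
        power2_eq_square algebra_simps)
  also have "t\<^sup>2 * ip g (op K g) \<le> t\<^sup>2 * (\<mu> * ip g g)"
    using le[OF g(1)] by (intro mult_left_mono) auto
  also have "\<dots> = t * ip g g" using t by (simp add: power2_eq_square)
  finally have "t * ip g g \<le> ip f g" by simp
  then have "\<mu> * (t * ip g g) \<le> \<mu> * ip f g" using \<open>\<mu> > 0\<close> by (intro mult_left_mono) auto
  then show ?thesis using t by (simp add: g_def mult.assoc[symmetric] mult.commute)
qed

text \<open>A maximising sequence \<open>f n\<close> of the Rayleigh quotient satisfies \<open>K f n - \<mu> f n \<rightarrow> 0\<close>, and
  by Arzela--Ascoli \<open>K f n\<close> has a uniformly convergent subsequence, whose limit is an eigenfunction.\<close>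

lemma top_eigenpair:
  assumes K: "psd_kernel K"
  obtains \<mu> e where "\<mu> \<ge> 0" "continuous_on UNIV e" "op K e = (\<lambda>x. \<mu> * e x)"
    "\<And>f. continuous_on UNIV f \<Longrightarrow> ip f (op K f) \<le> \<mu> * ip f f"
    "\<mu> > 0 \<Longrightarrow> ip e e = 1"
proof -
  have ck: "continuous_kernel K" and sym: "\<And>x y. K x y = K y x"
    and pos: "\<And>f. continuous_on UNIV f \<Longrightarrow> 0 \<le> ip f (op K f)"
    using K by (auto simp: psd_kernel_def)
  define S where "S = {ip f (op K f) | f. continuous_on UNIV f \<and> ip f f = 1}"
  define \<mu> where "\<mu> = Sup S"
  obtain B where B: "B > 0" "\<And>x y. x \<in> D \<Longrightarrow> y \<in> D \<Longrightarrow> \<bar>K x y\<bar> \<le> B"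
    using kernel_bounded[OF ck compact_D] by metis
  have "ip (\<lambda>x. 1) (\<lambda>x. 1) = 1" by (simp add: ip_def prob_space)
  then have S1: "ip (\<lambda>x. 1) (op K (\<lambda>x. 1)) \<in> S" unfolding S_def by force
  have op0: "op (\<lambda>x y. 0) f = (\<lambda>x. 0)" for f by (simp add: integral_operator_def fun_eq_iff)
  have "s \<le> B" if s: "s \<in> S" for s
  proof -
    obtain f where f: "continuous_on UNIV f" "ip f f = 1" "s = ip f (op K f)"
      using s by (auto simp: S_def)
    have "continuous_kernel (\<lambda>x y. 0)" by (simp add: continuous_kernel_def)
    from qform_diff_le[OF ck this f(1), of B] B(2) f(2,3) show ?thesis
      by (simp add: op0) (simp add: ip_def)
  qed
  then have bdd: "bdd_above S" by (auto simp: bdd_above_def)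
  have le: "ip f (op K f) \<le> \<mu> * ip f f" if f: "continuous_on UNIV f" for f
  proof (cases "ip f f = 0")
    case True
    then have "AE x in M. f x = 0" using ip_eq_0_iff f by simp
    then have "ip f (op K f) = ip (\<lambda>x. 0) (op K f)"
      using f ck by (intro ip_cong_AE op_continuous continuous_integrable) auto
    then show ?thesis using True by (simp add: ip_def)
  next
    case False
    then have p: "ip f f > 0" using ip_nonneg[of f] by simp
    define c where "c = 1 / sqrt (ip f f)"
    have c: "c * c * ip f f = 1" using p by (simp add: c_def)
    have o: "op K (\<lambda>x. c * f x) = (\<lambda>x. c * op K f x)" by (auto simp: op_scale)
    have "ip (\<lambda>x. c * f x) (op K (\<lambda>x. c * f x)) \<in> S"
      unfolding S_def using f c
      by (auto intro!: exI[of _ "\<lambda>x. c * f x"] continuous_intros simp: ip_scale_left ip_scale_right)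
    then have "c * c * ip f (op K f) \<le> \<mu>"
      unfolding \<mu>_def o ip_scale_left ip_scale_right using bdd by (auto intro: cSup_upper simp: mult.assoc)
    then have "c * c * ip f (op K f) * ip f f \<le> \<mu> * ip f f" using p by (intro mult_right_mono) auto
    then show ?thesis using c by (simp add: mult.assoc mult.left_commute) (metis mult.commute mult.left_commute mult.right_neutral)
  qed
  have "\<mu> \<ge> 0"
    using order_trans[OF pos[of "\<lambda>x. 1"] cSup_upper[OF S1 bdd]] by (simp add: \<mu>_def)
  show ?thesis
  proof (cases "\<mu> = 0")
    case True
    \<comment> \<open>The zero function is the witness here, which is why normalisation is promised
      only for \<open>\<mu> > 0\<close>.\<close>
    then show ?thesis using le that[of 0 "\<lambda>x. 0"] by (simp add: integral_operator_def fun_eq_iff)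
  next
    case False
    with \<open>\<mu> \<ge> 0\<close> have lp: "\<mu> > 0" by simp
    have "\<exists>f. continuous_on UNIV f \<and> ip f f = 1 \<and> \<mu> - 1 / Suc n < ip f (op K f)" for n
    proof -
      have "\<exists>s\<in>S. \<mu> - 1 / Suc n < s"
        unfolding \<mu>_def using S1 bdd by (subst less_cSup_iff[symmetric]) (auto simp: \<mu>_def)
      then show ?thesis by (auto simp: S_def)
    qed
    then obtain f where f: "\<And>n. continuous_on UNIV (f n)" "\<And>n. ip (f n) (f n) = 1"
      "\<And>n. \<mu> - 1 / Suc n < ip (f n) (op K (f n))" by metis
    have f_le: "ip (f n) (op K (f n)) \<le> \<mu>" for n using le[OF f(1), of n] f(2) by simp
    have f_abs: "(\<integral>x. \<bar>f n x\<bar> \<partial>M) \<le> 1" for n using integral_abs_le[OF f(1), of n] f(2) by simp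
    define h where "h = (\<lambda>n. op K (f n))"
    note fi = continuous_integrable[OF f(1)]
    have h: "continuous_on UNIV (h n)" for n unfolding h_def by (intro op_continuous ck fi)
    have hb: "norm (h n x) \<le> B" if "x \<in> D" for n x
    proof -
      have "\<bar>h n x\<bar> \<le> B * (\<integral>x. \<bar>f n x\<bar> \<partial>M)"
        unfolding h_def using ck fi B(2)[OF that] by (rule op_abs_le)
      also have "\<dots> \<le> B * 1" using B f_abs by (intro mult_left_mono) auto
      finally show ?thesis by simp
    qed
    \<comment> \<open>Equicontinuity is inherited from the kernel, uniformly in \<open>n\<close>, as
      the L1 norms of the \<open>f n\<close> are at most 1.\<close>
    have heq: "\<exists>d. 0 < d \<and> (\<forall>n y. y \<in> D \<and> norm (x - y) < d \<longrightarrow> norm (h n x - h n y) < e)"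
      if x: "x \<in> D" and e: "0 < e" for x e
    proof -
      obtain d where d: "d > 0" "\<And>x x' y. x \<in> D \<Longrightarrow> x' \<in> D \<Longrightarrow> dist x x' < d \<Longrightarrow> y \<in> D \<Longrightarrow>
          \<bar>K x y - K x' y\<bar> \<le> e / 2"
        using kernel_equicontinuous[OF ck compact_D, of "e / 2"] e by (metis half_gt_zero)
      have "norm (h n x - h n y) < e" if "y \<in> D" "norm (x - y) < d" for n y
      proof -
        have "\<bar>h n x - h n y\<bar> \<le> e / 2 * (\<integral>x. \<bar>f n x\<bar> \<partial>M)"
          unfolding h_def using ck ck fi
          by (rule op_diff_le) (use d(2)[OF x that(1)] that(2) in \<open>auto simp: dist_norm\<close>)
        also have "\<dots> \<le> e / 2 * 1" using e f_abs by (intro mult_left_mono) auto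
        finally show ?thesis using e by simp
      qed
      then show ?thesis using d(1) by blast
    qed
    obtain g r where g: "continuous_on D g" and r: "strict_mono (r :: nat \<Rightarrow> nat)"
      and lim: "\<And>e. 0 < e \<Longrightarrow> \<exists>N. \<forall>n x. n \<ge> N \<and> x \<in> D \<longrightarrow> norm (h (r n) x - g x) < e"
      using Arzela_Ascoli[OF compact_D hb heq] by metis
    \<comment> \<open>The limit is known to be continuous on \<open>D\<close> only; extended by zero
      it is measurable on the whole space.\<close>
    define g0 where "g0 = (\<lambda>x. indicator D x *\<^sub>R g x)"
    have "closed D" using compact_D by (rule compact_imp_closed)
    then have g0m: "g0 \<in> borel_measurable M"
      using borel_measurable_continuous_on_indicator[OF _ g] \<open>closed D\<close>
      by (simp add: g0_def[abs_def] cong: measurable_cong_sets[OF sets_M refl])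
    have g0D: "x \<in> D \<Longrightarrow> g0 x = g x" for x by (simp add: g0_def)
    obtain Bg where Bg: "\<And>x. x \<in> D \<Longrightarrow> \<bar>g x\<bar> \<le> Bg"
      using compact_continuous_image[OF g compact_D] compact_imp_bounded[of "g ` D"]
      by (auto simp: bounded_iff)
    have g0i: "integrable M g0"
      using g0m Bg by (intro bounded_integrable) (auto simp: g0D)
    have lim0: "\<exists>N. \<forall>n x. n \<ge> N \<and> x \<in> D \<longrightarrow> norm (h (r n) x - g0 x) < e" if "e > 0" for e
      using lim[OF that] g0D by (metis (no_types, lifting))
    have lim_op: "(\<lambda>n. op K (h (r n)) x) \<longlonglongrightarrow> op K g0 x" for x
      using ck h g0m g0i lim0 by (rule op_LIMSEQ_uniform)
    have lim_h: "(\<lambda>n. h (r n) x) \<longlonglongrightarrow> g0 x" if "x \<in> D" for x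
      unfolding LIMSEQ_iff using lim0 that by blast
    have res: "ip (\<lambda>x. h n x - \<mu> * f n x) (\<lambda>x. h n x - \<mu> * f n x) = ip (h n) (h n) - 2 * \<mu> * ip (f n) (h n) + \<mu>\<^sup>2" for n
      using f h by (simp add: ip_diff_left ip_diff_right ip_scale_left ip_scale_right continuous_on_diff
          continuous_on_mult ip_commute[of "h n" "f n"] power2_eq_square algebra_simps)
    \<comment> \<open>The squared residual is at most \<open>\<mu>\<close> times the gap between the
      Rayleigh quotient of \<open>f n\<close> and its supremum.\<close>
    have res_le: "ip (\<lambda>x. h n x - \<mu> * f n x) (\<lambda>x. h n x - \<mu> * f n x) \<le> \<mu> / Suc n" for n
    proof -
      have "ip (h n) (h n) \<le> \<mu> * ip (f n) (h n)"
        unfolding h_def using K f(1) lp le by (rule psd_kernel_op_norm_le)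
      then have "ip (\<lambda>x. h n x - \<mu> * f n x) (\<lambda>x. h n x - \<mu> * f n x) \<le> \<mu> * (\<mu> - ip (f n) (h n))"
        unfolding res by (simp add: power2_eq_square algebra_simps)
      also have "\<dots> \<le> \<mu> * (1 / Suc n)"
        using f(3)[of n] lp unfolding h_def by (intro mult_left_mono) auto
      finally show ?thesis by simp
    qed
    have to0: "(\<lambda>n. op K (\<lambda>x. h n x - \<mu> * f n x) x) \<longlonglongrightarrow> 0" if x: "x \<in> D" for x
    proof (rule Lim_null_comparison)
      show "\<forall>\<^sub>F n in sequentially. norm (op K (\<lambda>x. h n x - \<mu> * f n x) x) \<le> B * sqrt (\<mu> / Suc n)"
      proof (rule always_eventually, rule allI)
        fix n
        have c: "continuous_on UNIV (\<lambda>x. h n x - \<mu> * f n x)"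
          using f h by (intro continuous_intros) auto
        have "\<bar>op K (\<lambda>x. h n x - \<mu> * f n x) x\<bar> \<le> B * (\<integral>x. \<bar>h n x - \<mu> * f n x\<bar> \<partial>M)"
          using ck continuous_integrable[OF c] B(2)[OF x] by (rule op_abs_le)
        also have "\<dots> \<le> B * sqrt (\<mu> / Suc n)"
          using B integral_abs_le[OF c] res_le[of n]
          by (intro mult_left_mono) (auto intro: order_trans)
        finally show "norm (op K (\<lambda>x. h n x - \<mu> * f n x) x) \<le> B * sqrt (\<mu> / Suc n)" by simp
      qed
      have "(\<lambda>n. B * sqrt (\<mu> * (1 / Suc n))) \<longlonglongrightarrow> B * sqrt (\<mu> * 0)"
        by (intro tendsto_intros LIMSEQ_inverse_real_of_nat[unfolded inverse_eq_divide])
      then show "(\<lambda>n. B * sqrt (\<mu> / Suc n)) \<longlonglongrightarrow> 0" by simp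
    qed
    have eig: "op K g0 x = \<mu> * g0 x" if x: "x \<in> D" for x
    proof -
      \<comment> \<open>Applying the operator to the residual leaves an expression in
        \<open>h n\<close> alone, and \<open>h\<close> has the convergent subsequence.\<close>
      have "op K (\<lambda>x. h n x - \<mu> * f n x) x = op K (h n) x - \<mu> * h n x" for n
        using f h by (simp add: op_diff[OF ck] continuous_integrable continuous_on_mult op_scale h_def)
      then have "(\<lambda>n. op K (h n) x - \<mu> * h n x) \<longlonglongrightarrow> 0" using to0[OF x] by simp
      then have "(\<lambda>n. op K (h (r n)) x - \<mu> * h (r n) x) \<longlonglongrightarrow> 0"
        using LIMSEQ_subseq_LIMSEQ[OF _ r] by (fastforce simp: o_def)
      moreover have "(\<lambda>n. op K (h (r n)) x - \<mu> * h (r n) x) \<longlonglongrightarrow> op K g0 x - \<mu> * g0 x"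
        by (intro tendsto_intros lim_op lim_h x)
      ultimately show ?thesis using LIMSEQ_unique by fastforce
    qed
    \<comment> \<open>One more application of the operator yields a function that is continuous
      everywhere and agrees with \<open>g0\<close> on \<open>D\<close>.\<close>
    define e1 where "e1 = (\<lambda>x. op K g0 x / \<mu>)"
    have e1: "continuous_on UNIV e1"
      unfolding e1_def using op_continuous[OF ck g0i] lp by (intro continuous_intros) auto
    have e1D: "e1 x = g0 x" if "x \<in> D" for x using eig[OF that] lp by (simp add: e1_def)
    have ae: "AE x in M. e1 x = g0 x" using AE_D by eventually_elim (rule e1D)
    have op_e1: "op K e1 = (\<lambda>x. \<mu> * e1 x)"
      using op_cong_AE[OF ck continuous_measurable[OF e1] g0m ae] lp by (auto simp: e1_def)
    \<comment> \<open>The limit is not zero: expanding the nonnegative squared residual bounds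
      \<open>ip (h n) (h n)\<close> from below by \<open>\<mu>\<^sup>2\<close> up to a vanishing
      term.\<close>
    have "\<mu>\<^sup>2 \<le> ip e1 e1"
    proof (rule LIMSEQ_le)
      show "(\<lambda>n. ip (h (r n)) (h (r n))) \<longlonglongrightarrow> ip e1 e1"
        unfolding ip_def
      proof (rule integral_dominated_convergence[where w = "\<lambda>x. B * B"])
        show "AE x in M. (\<lambda>n. h (r n) x * h (r n) x) \<longlonglongrightarrow> e1 x * e1 x"
          using AE_D by eventually_elim (auto simp: e1D intro!: tendsto_mult lim_h)
        show "AE x in M. norm (h (r n) x * h (r n) x) \<le> B * B" for n
          using AE_D
        proof eventually_elim
          case (elim x)
          show ?case unfolding norm_mult by (rule mult_mono) (use hb[OF elim] B(1) in auto)
        qed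
      qed (use e1 h in \<open>auto intro!: continuous_measurable continuous_on_mult\<close>)
      have "(\<lambda>n. \<mu>\<^sup>2 - 2 * \<mu> * (1 / Suc n)) \<longlonglongrightarrow> \<mu>\<^sup>2 - 2 * \<mu> * 0"
        by (intro tendsto_intros LIMSEQ_inverse_real_of_nat[unfolded inverse_eq_divide])
      then have "(\<lambda>n. \<mu>\<^sup>2 - 2 * \<mu> * (1 / Suc n)) \<longlonglongrightarrow> \<mu>\<^sup>2" by simp
      from LIMSEQ_subseq_LIMSEQ[OF this r] show "(\<lambda>n. \<mu>\<^sup>2 - 2 * \<mu> * (1 / Suc (r n))) \<longlonglongrightarrow> \<mu>\<^sup>2"
        by (simp add: o_def)
      have "\<mu>\<^sup>2 - 2 * \<mu> * (1 / Suc n) \<le> ip (h n) (h n)" for n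
      proof -
        have "0 \<le> ip (h n) (h n) - 2 * \<mu> * ip (f n) (h n) + \<mu>\<^sup>2"
          unfolding res[symmetric] by (rule ip_nonneg)
        moreover have "2 * \<mu> * (\<mu> - 1 / Suc n) \<le> 2 * \<mu> * ip (f n) (h n)"
          using f(3)[of n] lp unfolding h_def by (intro mult_left_mono) auto
        ultimately show ?thesis by (simp add: power2_eq_square algebra_simps)
      qed
      then show "\<exists>N. \<forall>n\<ge>N. \<mu>\<^sup>2 - 2 * \<mu> * (1 / Suc (r n)) \<le> ip (h (r n)) (h (r n))" by blast
    qed
    then have p: "ip e1 e1 > 0" using lp by (meson less_le_trans zero_less_power)
    define c where "c = 1 / sqrt (ip e1 e1)"
    have c: "c * (c * ip e1 e1) = 1" using p by (simp add: c_def)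
    show ?thesis
    proof (rule that)
      show "\<mu> \<ge> 0" by fact
      show "continuous_on UNIV (\<lambda>x. c * e1 x)" using e1 by (intro continuous_intros)
      show "op K (\<lambda>x. c * e1 x) = (\<lambda>x. \<mu> * (c * e1 x))" by (auto simp: op_scale op_e1)
      show "ip (\<lambda>x. c * e1 x) (\<lambda>x. c * e1 x) = 1" using c by (simp add: ip_scale_left ip_scale_right)
    qed (rule le)
  qed
qed

end

section \<open>Eigenvalues and finite rank approximation\<close>

text \<open>Gaussian elimination by induction on the equations: a pivot \<open>p\<close> of equation
  \<open>a\<close> is eliminated from the others, which costs one equation and one unknown.\<close>

lemma homogeneous_system_nontrivial_solution:
  fixes m :: "'b \<Rightarrow> 'i \<Rightarrow> real"
  assumes "finite A" "finite I" "card A < card I"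
  shows "\<exists>c. (\<exists>i\<in>I. c i \<noteq> 0) \<and> (\<forall>a\<in>A. (\<Sum>i\<in>I. c i * m a i) = 0)"
  using assms
proof (induction A arbitrary: I m rule: finite_induct)
  case empty
  then have "I \<noteq> {}" by auto
  then show ?case by (intro exI[of _ "\<lambda>_. 1"]) auto
next
  case (insert a A)
  show ?case
  proof (cases "\<forall>i\<in>I. m a i = 0")
    case True
    have "card A < card I" using insert by simp
    then obtain c where "\<exists>i\<in>I. c i \<noteq> 0" "\<forall>a\<in>A. (\<Sum>i\<in>I. c i * m a i) = 0"
      using insert.IH[OF \<open>finite I\<close>, of m] by blast
    then show ?thesis using True by (intro exI[of _ c]) auto
  next
    case False
    then obtain p where p: "p \<in> I" "m a p \<noteq> 0" by blast
    define J where "J = I - {p}"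
    have J: "finite J" "p \<notin> J" "I = insert p J" using p insert by (auto simp: J_def)
    then have "card A < card J" using insert by simp
    then obtain c where c: "\<exists>i\<in>J. c i \<noteq> 0"
      "\<forall>b\<in>A. (\<Sum>i\<in>J. c i * (m b i - m b p * m a i / m a p)) = 0"
      using insert.IH[OF J(1), of "\<lambda>b i. m b i - m b p * m a i / m a p"] by blast
    define t where "t = (\<Sum>i\<in>J. c i * m a i)"
    \<comment> \<open>The eliminated unknown is recovered from equation \<open>a\<close>.\<close>
    define c' where "c' = c(p := - t / m a p)"
    have *: "(\<Sum>i\<in>I. c' i * m b i) = (\<Sum>i\<in>J. c i * m b i) - t * m b p / m a p" for b
    proof -
      have "(\<Sum>i\<in>J. c' i * m b i) = (\<Sum>i\<in>J. c i * m b i)"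
        using J(2) by (intro sum.cong) (auto simp: c'_def)
      then show ?thesis using J by (simp add: c'_def)
    qed
    have "(\<Sum>i\<in>J. c i * m b i) = t * m b p / m a p" if "b \<in> A" for b
    proof -
      have "0 = (\<Sum>i\<in>J. c i * (m b i - m b p * m a i / m a p))"
        using c(2) that by simp
      also have "\<dots> = (\<Sum>i\<in>J. c i * m b i - c i * m a i * (m b p / m a p))"
        by (intro sum.cong refl) (simp add: algebra_simps)
      also have "\<dots> = (\<Sum>i\<in>J. c i * m b i) - t * (m b p / m a p)"
        by (simp add: sum_subtractf t_def sum_distrib_right sum_divide_distrib)
      finally show ?thesis by simp
    qed
    moreover have "(\<Sum>i\<in>J. c i * m a i) = t * m a p / m a p" using p by (simp add: t_def)
    ultimately have "\<forall>b\<in>insert a A. (\<Sum>i\<in>I. c' i * m b i) = 0" by (auto simp: *)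
    moreover have "\<exists>i\<in>I. c' i \<noteq> 0" using c(1) J by (auto simp: c'_def)
    ultimately show ?thesis by blast
  qed
qed

context compact_prob
begin

definition AE_independent :: "'i set \<Rightarrow> ('i \<Rightarrow> 'a \<Rightarrow> real) \<Rightarrow> bool" where
  "AE_independent I f \<longleftrightarrow> (\<forall>c. (AE x in M. (\<Sum>i\<in>I. c i * f i x) = 0) \<longrightarrow> (\<forall>i\<in>I. c i = 0))"

lemma eigenfunctions_orthogonal:
  assumes K: "continuous_kernel K" and sym: "\<And>x y. K x y = K y x"
    and f: "continuous_on UNIV f" "op K f = (\<lambda>x. \<mu> * f x)"
    and g: "continuous_on UNIV g" "op K g = (\<lambda>x. \<nu> * g x)"
    and "\<mu> \<noteq> \<nu>"
  shows "ip f g = 0"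
  using op_selfadjoint[OF K sym f(1) g(1)] \<open>\<mu> \<noteq> \<nu>\<close> by (simp add: f g ip_scale_left ip_scale_right)

text \<open>A combination \<open>h\<close> of the eigenfunctions is orthogonal to the rows of \<open>G\<close>, so that
  \<open>l \<parallel>h\<parallel>\<^sup>2 \<le> \<langle>h, K h\<rangle> = \<langle>h, (K - G) h\<rangle> \<le> \<delta> \<parallel>h\<parallel>\<^sup>2\<close>.\<close>

lemma eigenvalues_le_finite_rank_error:
  assumes K: "continuous_kernel K" and sym: "\<And>x y. K x y = K y x"
    and G: "continuous_kernel G"
    and \<phi>: "finite A" "\<And>a. a \<in> A \<Longrightarrow> continuous_on UNIV (\<phi> a)"
      "\<And>x. \<exists>b. \<forall>y. G x y = (\<Sum>a\<in>A. b a * \<phi> a y)"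
    and close: "\<And>x y. x \<in> D \<Longrightarrow> y \<in> D \<Longrightarrow> \<bar>K x y - G x y\<bar> \<le> \<delta>"
    and I: "finite I" "card A < card I"
    and f: "\<And>i. i \<in> I \<Longrightarrow> continuous_on UNIV (f i)"
      "\<And>i. i \<in> I \<Longrightarrow> op K (f i) = (\<lambda>x. \<mu> i * f i x)"
      "\<And>i. i \<in> I \<Longrightarrow> l \<le> \<mu> i"
      "AE_independent I f"
  shows "l \<le> \<delta>"
proof -
  obtain c where c: "\<exists>i\<in>I. c i \<noteq> 0" "\<forall>a\<in>A. (\<Sum>i\<in>I. c i * ip (\<phi> a) (f i)) = 0"
    using homogeneous_system_nontrivial_solution[OF \<phi>(1) I, of "\<lambda>a i. ip (\<phi> a) (f i)"] by blast
  define h where "h = (\<lambda>x. \<Sum>i\<in>I. c i * f i x)"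
  have cc: "continuous_on UNIV (\<lambda>x. b i * f i x)" if "i \<in> I" for b :: "_ \<Rightarrow> real" and i
    using f(1)[OF that] by (intro continuous_intros)
  have comb: "continuous_on UNIV (\<lambda>x. \<Sum>i\<in>I. b i * f i x)" for b
    using cc by (intro continuous_on_sum) auto
  have h: "continuous_on UNIV h" unfolding h_def by (rule comb)
  have pos: "ip h h > 0"
  proof -
    have "\<not> (AE x in M. h x = 0)"
      using f(4) c(1) unfolding AE_independent_def h_def by blast
    then show ?thesis using ip_eq_0_iff[OF h] ip_nonneg[of h] by linarith
  qed
  have ipcomb: "ip (\<lambda>x. \<Sum>i\<in>I. b i * f i x) (\<lambda>x. \<Sum>i\<in>I. d i * f i x) =
      (\<Sum>i\<in>I. \<Sum>j\<in>I. b i * d j * ip (f i) (f j))" for b d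
  proof -
    have "ip (\<lambda>x. \<Sum>i\<in>I. b i * f i x) (\<lambda>x. \<Sum>i\<in>I. d i * f i x) =
        (\<Sum>i\<in>I. b i * ip (f i) (\<lambda>x. \<Sum>i\<in>I. d i * f i x))"
      using cc comb by (simp add: ip_sum_left ip_scale_left)
    also have "\<dots> = (\<Sum>i\<in>I. b i * (\<Sum>j\<in>I. d j * ip (f i) (f j)))"
      using f(1) cc by (intro sum.cong refl arg_cong2[where f = times])
        (simp add: ip_sum_right ip_scale_right)
    finally show ?thesis by (simp add: sum_distrib_left mult.assoc)
  qed
  have opG: "op G h x = 0" for x
  proof -
    obtain b where b: "\<And>y. G x y = (\<Sum>a\<in>A. b a * \<phi> a y)" using \<phi>(3) by metis
    have "ip (\<phi> a) h = 0" if "a \<in> A" for a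
      using c(2) that \<phi>(2)[OF that] cc by (simp add: h_def ip_sum_right ip_scale_right)
    moreover have "op G h x = ip (\<lambda>y. \<Sum>a\<in>A. b a * \<phi> a y) h"
      by (simp add: integral_operator_def ip_def b)
    moreover have "\<dots> = (\<Sum>a\<in>A. b a * ip (\<phi> a) h)"
      using \<phi>(2) h by (simp add: ip_sum_left ip_scale_left continuous_on_mult)
    ultimately show ?thesis by simp
  qed
  have opK: "op K h = (\<lambda>x. \<Sum>i\<in>I. (c i * \<mu> i) * f i x)"
  proof
    fix x
    have "op K h x = (\<Sum>i\<in>I. op K (\<lambda>x. c i * f i x) x)"
      unfolding h_def using K cc by (intro op_sum continuous_integrable) auto
    then show "op K h x = (\<Sum>i\<in>I. (c i * \<mu> i) * f i x)" by (simp add: op_scale f(2) mult.assoc)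
  qed
  \<comment> \<open>The \<open>f i\<close> of one eigenvalue need not be orthogonal to each other.
    Cross terms between different eigenvalues vanish, and for equal ones the factor
    \<open>\<mu> j - l\<close> splits into two equal square roots, so the form of
    \<open>K - l\<close> at \<open>h\<close> is the squared norm of the combination with
    coefficients \<open>d\<close>.\<close>
  define d where "d = (\<lambda>i. c i * sqrt (\<mu> i - l))"
  have "ip h (op K h) - l * ip h h = (\<Sum>i\<in>I. \<Sum>j\<in>I. c i * c j * (\<mu> j - l) * ip (f i) (f j))"
    unfolding opK unfolding h_def ipcomb by (simp add: sum_distrib_left sum_subtractf[symmetric] algebra_simps)
  also have "\<dots> = (\<Sum>i\<in>I. \<Sum>j\<in>I. d i * d j * ip (f i) (f j))"
  proof (intro sum.cong refl)
    fix i j assume ij: "i \<in> I" "j \<in> I"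
    show "c i * c j * (\<mu> j - l) * ip (f i) (f j) = d i * d j * ip (f i) (f j)"
    proof (cases "\<mu> i = \<mu> j")
      case True
      then show ?thesis using f(3)[OF ij(2)] by (simp add: d_def)
    next
      case False
      then have "ip (f i) (f j) = 0" using ij f by (intro eigenfunctions_orthogonal[OF K sym]) auto
      then show ?thesis by simp
    qed
  qed
  also have "\<dots> = ip (\<lambda>x. \<Sum>i\<in>I. d i * f i x) (\<lambda>x. \<Sum>i\<in>I. d i * f i x)" by (rule ipcomb[symmetric])
  also have "\<dots> \<ge> 0" by (rule ip_nonneg)
  finally have "l * ip h h \<le> ip h (op K h)" by simp
  also have "\<dots> \<le> \<delta> * ip h h"
    using qform_diff_le[OF K G h close] by (simp add: opG ip_def)
  finally show ?thesis using pos by simp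
qed

text \<open>Positivity survives because the form of \<open>L\<close> at \<open>f\<close> is the form
  of \<open>K\<close> at \<open>f\<close> minus its component \<open>ip e f\<close> along
  \<open>e\<close>.\<close>

lemma psd_kernel_deflate:
  assumes K: "psd_kernel K" and e: "continuous_on UNIV e" "op K e = (\<lambda>x. \<mu> * e x)"
    and \<mu>: "\<mu> \<ge> 0" "\<mu> > 0 \<Longrightarrow> ip e e = 1"
  defines "L \<equiv> \<lambda>x y. K x y - \<mu> * e x * e y"
  shows "psd_kernel L" "\<And>f. continuous_on UNIV f \<Longrightarrow> op L f x = op K f x - \<mu> * ip e f * e x"
proof -
  have ck: "continuous_kernel K" and sym: "\<And>x y. K x y = K y x"
    and pos: "\<And>f. continuous_on UNIV f \<Longrightarrow> 0 \<le> ip f (op K f)"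
    using K by (auto simp: psd_kernel_def)
  have cL: "continuous_kernel L"
    using ck unfolding continuous_kernel_def L_def
    by (intro continuous_intros continuous_on_compose2[OF e(1)]) auto
  have op: "op L f x = op K f x - \<mu> * ip e f * e x" if f: "continuous_on UNIV f" for f x
  proof -
    have "integrable M (\<lambda>y. \<mu> * e x * (e y * f y))"
      using e f by (intro integrable_mult_right continuous_integrable continuous_intros)
    moreover have "integrable M (\<lambda>y. K x y * f y)"
      using ck f by (intro kernel_integrable continuous_integrable)
    moreover have "op L f x = (\<integral>y. K x y * f y - \<mu> * e x * (e y * f y) \<partial>M)"
      unfolding integral_operator_def L_def
      by (intro Bochner_Integration.integral_cong) (auto simp: algebra_simps)
    ultimately show ?thesis
      by (simp add: integral_operator_def ip_def)
  qed
  then show "\<And>f. continuous_on UNIV f \<Longrightarrow> op L f x = op K f x - \<mu> * ip e f * e x" .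
  have "0 \<le> ip f (op L f)" if f: "continuous_on UNIV f" for f
  proof -
    define a where "a = ip e f"
    define g where "g = (\<lambda>x. f x - a * e x)"
    have ae: "continuous_on UNIV (\<lambda>x. b * e x)" for b
      using e(1) by (intro continuous_intros)
    have g: "continuous_on UNIV g" unfolding g_def using e f by (intro continuous_intros)
    have Kf: "continuous_on UNIV (op K f)" using f ck by (intro op_continuous continuous_integrable)
    have eKf: "ip e (op K f) = \<mu> * a"
      unfolding op_selfadjoint[OF ck sym e(1) f] by (simp add: e ip_scale_left a_def)
    have opg: "op K g = (\<lambda>x. op K f x - a * \<mu> * e x)"
      unfolding g_def
      using op_diff[OF ck continuous_integrable[OF f] continuous_integrable[OF ae]]
      by (simp add: fun_eq_iff op_scale e)
    have "ip g (op K g) = ip f (op K f) - a * \<mu> * ip f e - a * (\<mu> * a - a * \<mu> * ip e e)"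
      unfolding opg unfolding g_def
      by (simp add: f e(1) Kf ae ip_diff_left ip_diff_right ip_scale_left ip_scale_right eKf
          continuous_on_diff)
    \<comment> \<open>For \<open>\<mu> = 0\<close> the function \<open>e\<close> may fail to be
      normalised, but then both sides vanish.\<close>
    moreover have "\<mu> * (a * (a * ip e e)) = \<mu> * (a * a)" using \<mu> by (cases "\<mu> = 0") auto
    moreover have "ip f e = a" by (simp add: a_def ip_commute[of f e])
    moreover have "op L f = (\<lambda>x. op K f x - (\<mu> * a) * e x)" using op[OF f] by (simp add: a_def fun_eq_iff)
    then have "ip f (op L f) = ip f (op K f) - \<mu> * a * ip f e"
      by (simp add: f Kf ae ip_diff_right ip_scale_right)
    ultimately have "ip f (op L f) = ip g (op K g)" by (simp add: algebra_simps)
    then show ?thesis using pos[OF g] by simp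
  qed
  then show "psd_kernel L" using cL sym by (auto simp: psd_kernel_def L_def)
qed

text \<open>The top eigenpair is split off again and again; the last conclusion bounds what remains
  after \<open>n\<close> steps and replaces completeness. The process goes on with zero values once
  the operator is exhausted, so the claims about \<open>e n\<close> as an eigenfunction are
  conditional on \<open>\<mu> n > 0\<close>.\<close>

lemma spectral_sequence:
  assumes K: "psd_kernel K"
  obtains \<mu> :: "nat \<Rightarrow> real" and e :: "nat \<Rightarrow> 'a \<Rightarrow> real" where
    "\<And>n. \<mu> (Suc n) \<le> \<mu> n" "\<And>n. 0 \<le> \<mu> n" "\<And>n. continuous_on UNIV (e n)"
    "\<And>n. \<mu> n > 0 \<Longrightarrow> ip (e n) (e n) = 1"
    "\<And>m n. m \<noteq> n \<Longrightarrow> \<mu> m > 0 \<Longrightarrow> \<mu> n > 0 \<Longrightarrow> ip (e m) (e n) = 0"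
    "\<And>n. \<mu> n > 0 \<Longrightarrow> op K (e n) = (\<lambda>x. \<mu> n * e n x)"
    "\<And>f n. continuous_on UNIV f \<Longrightarrow>
       ip f (op K f) \<le> \<mu> n * ip f f + (\<Sum>i<n. \<mu> i * (ip (e i) f)\<^sup>2)"
proof -
  define good where "good = (\<lambda>(L, \<mu>, e). psd_kernel L \<and> \<mu> \<ge> 0 \<and> continuous_on UNIV e \<and>
    op L e = (\<lambda>x. \<mu> * e x) \<and> (\<forall>f. continuous_on UNIV f \<longrightarrow> ip f (op L f) \<le> \<mu> * ip f f) \<and>
    (\<mu> > 0 \<longrightarrow> ip e e = 1))"
  have ex: "\<exists>\<mu> e. good (L, \<mu>, e)" if L: "psd_kernel L" for L
    by (rule top_eigenpair[OF L]) (use L in \<open>auto simp: good_def\<close>)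
  \<comment> \<open>Dependent choice leaves the initial state free; the clause for
    \<open>n = 0\<close> pins its kernel to \<open>K\<close>.\<close>
  have "\<exists>s. \<forall>n. (good (s n) \<and> (n = 0 \<longrightarrow> fst (s n) = K)) \<and>
      (\<lambda>(L, \<mu>, e). fst (s (Suc n)) = (\<lambda>x y. L x y - \<mu> * e x * e y)) (s n)"
  proof (rule dependent_nat_choice)
    show "\<exists>s. good s \<and> (0 = (0::nat) \<longrightarrow> fst s = K)" using ex[OF K] by auto
    fix s and n :: nat assume *: "good s \<and> (n = 0 \<longrightarrow> fst s = K)"
    obtain L \<mu> e where s: "s = (L, \<mu>, e)" by (cases s)
    have "psd_kernel (\<lambda>x y. L x y - \<mu> * e x * e y)"
      using * by (intro psd_kernel_deflate) (auto simp: s good_def)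
    from ex[OF this] show "\<exists>s'. (good s' \<and> (Suc n = 0 \<longrightarrow> fst s' = K)) \<and>
        (\<lambda>(L, \<mu>, e). fst s' = (\<lambda>x y. L x y - \<mu> * e x * e y)) s"
      by (auto simp: s)
  qed
  then obtain s where *: "\<forall>n. (good (s n) \<and> (n = 0 \<longrightarrow> fst (s n) = K)) \<and>
      (\<lambda>(L, \<mu>, e). fst (s (Suc n)) = (\<lambda>x y. L x y - \<mu> * e x * e y)) (s n)" by (rule exE)
  have s: "good (s n)" "fst (s 0) = K"
    "(\<lambda>(L, \<mu>, e). fst (s (Suc n)) = (\<lambda>x y. L x y - \<mu> * e x * e y)) (s n)" for n
    using spec[OF *, of n] spec[OF *, of 0] by simp_all
  define L \<mu> e where "L = (\<lambda>n. fst (s n))" and "\<mu> = (\<lambda>n. fst (snd (s n)))"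
    and "e = (\<lambda>n. snd (snd (s n)))"
  have L0: "L 0 = K" using s(2) by (simp add: L_def)
  have LS: "L (Suc n) = (\<lambda>x y. L n x y - \<mu> n * e n x * e n y)" for n
    using s(3)[of n] by (simp add: L_def \<mu>_def e_def split_beta)
  have psd: "psd_kernel (L n)" and \<mu>0: "\<mu> n \<ge> 0" and e: "continuous_on UNIV (e n)"
    and ope: "op (L n) (e n) = (\<lambda>x. \<mu> n * e n x)"
    and le: "continuous_on UNIV f \<Longrightarrow> ip f (op (L n) f) \<le> \<mu> n * ip f f"
    and e1: "\<mu> n > 0 \<Longrightarrow> ip (e n) (e n) = 1" for n f
    using s(1)[of n] by (auto simp: good_def L_def \<mu>_def e_def split_beta)
  have ck: "continuous_kernel (L n)" and sym: "L n x y = L n y x" for n x y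
    using psd[of n] by (auto simp: psd_kernel_def)
  have opS: "op (L (Suc n)) f x = op (L n) f x - \<mu> n * ip (e n) f * e n x"
    if "continuous_on UNIV f" for n f x
    unfolding LS using psd e ope \<mu>0 e1 that by (rule psd_kernel_deflate(2))
  have opn: "op (L n) f x = op K f x - (\<Sum>i<n. \<mu> i * ip (e i) f * e i x)"
    if f: "continuous_on UNIV f" for n f x
    by (induction n) (simp_all add: L0 opS[OF f])
  \<comment> \<open>Every extracted function is annihilated by all later kernels. Together with
    self-adjointness this makes later eigenfunctions orthogonal to it.\<close>
  have zero: "op (L j) (e i) x = 0" if "i < j" for i j x
    using that
  proof (induction j arbitrary: x)
    case (Suc j)
    show ?case
    proof (cases "i = j")
      case True
      have "\<mu> j * ip (e j) (e j) = \<mu> j" using \<mu>0[of j] e1[of j] by (cases "\<mu> j = 0") auto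
      then show ?thesis by (simp add: opS e ope True)
    next
      case False
      with Suc have IH: "op (L j) (e i) = (\<lambda>x. 0)" by (auto simp: fun_eq_iff)
      have "\<mu> j * ip (e j) (e i) = ip (e j) (op (L j) (e i))"
        unfolding op_selfadjoint[OF ck sym e e] ope ip_scale_left ..
      also have "\<dots> = 0" by (simp add: IH ip_def)
      finally show ?thesis by (simp add: opS e IH)
    qed
  qed simp
  have orth': "ip (e j) (e i) = 0" if "i < j" "\<mu> j > 0" for i j
  proof -
    have "\<mu> j * ip (e j) (e i) = ip (e j) (op (L j) (e i))"
      unfolding op_selfadjoint[OF ck sym e e] ope ip_scale_left ..
    also have "\<dots> = 0" using zero[OF that(1)] by (simp add: ip_def)
    finally show ?thesis using that by simp
  qed
  have ipn: "ip f (op (L n) f) = ip f (op K f) - (\<Sum>i<n. \<mu> i * (ip (e i) f)\<^sup>2)"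
    if f: "continuous_on UNIV f" for f n
  proof -
    have cK: "continuous_on UNIV (op K f)"
      using op_continuous[OF ck[of 0] continuous_integrable[OF f]] by (simp add: L0)
    have ce: "continuous_on UNIV (\<lambda>x. \<mu> i * ip (e i) f * e i x)" for i
      using e by (intro continuous_intros)
    have "op (L n) f = (\<lambda>x. op K f x - (\<Sum>i<n. \<mu> i * ip (e i) f * e i x))"
      using opn[OF f] by auto
    then have "ip f (op (L n) f) = ip f (op K f) - (\<Sum>i<n. \<mu> i * ip (e i) f * ip f (e i))"
      by (simp add: ip_diff_right ip_sum_right ip_scale_right cK ce f continuous_on_sum)
    then show ?thesis by (simp add: ip_commute[of f] power2_eq_square mult.assoc)
  qed
  show ?thesis
  proof (rule that)
    show "\<mu> (Suc n) \<le> \<mu> n" for n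
    proof (cases "\<mu> (Suc n) = 0")
      case False
      then have p: "\<mu> (Suc n) > 0" using \<mu>0[of "Suc n"] by simp
      let ?e = "e (Suc n)"
      have "\<mu> (Suc n) = ip ?e (op (L (Suc n)) ?e)" by (simp add: ope ip_scale_right e1[OF p])
      \<comment> \<open>Passing from \<open>L n\<close> to \<open>L (Suc n)\<close> only removes a
        nonnegative square from the form.\<close>
      also have "\<dots> \<le> ip ?e (op (L n) ?e)"
        using \<mu>0[of n] by (simp add: ipn[OF e])
      also have "\<dots> \<le> \<mu> n" using le[OF e, of "Suc n" n] e1[OF p] by simp
      finally show ?thesis .
    qed (simp add: \<mu>0)
    show orth: "ip (e m) (e n) = 0" if "m \<noteq> n" "\<mu> m > 0" "\<mu> n > 0" for m n
      using that orth'[of m n] orth'[of n m] ip_commute by (cases "m < n") auto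
    show "op K (e n) = (\<lambda>x. \<mu> n * e n x)" if "\<mu> n > 0" for n
    proof -
      have "(\<Sum>i<n. \<mu> i * ip (e i) (e n) * e i x) = 0" for x
        using orth'[of _ n] \<open>\<mu> n > 0\<close> by (intro sum.neutral) (auto simp: ip_commute[of _ "e n"])
      then show ?thesis using opn[OF e, of n n] ope[of n] by (auto simp: fun_eq_iff)
    qed
    show "ip f (op K f) \<le> \<mu> n * ip f f + (\<Sum>i<n. \<mu> i * (ip (e i) f)\<^sup>2)"
      if "continuous_on UNIV f" for f n
      using ipn[OF that, of n] le[OF that, of n] by simp
  qed (use \<mu>0 e e1 in auto)
qed

section \<open>Continuous eigenfunctions, dimensions of eigenspaces and counting\<close>

lemma AE_independent_orthonormal:
  assumes "finite I" "\<And>i. i \<in> I \<Longrightarrow> continuous_on UNIV (f i)"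
    and orth: "\<And>i j. i \<in> I \<Longrightarrow> j \<in> I \<Longrightarrow> ip (f i) (f j) = (if i = j then 1 else 0)"
  shows "AE_independent I f"
  unfolding AE_independent_def
proof (intro allI impI ballI)
  fix c j assume 0: "AE x in M. (\<Sum>i\<in>I. c i * f i x) = 0" and j: "j \<in> I"
  have c: "continuous_on UNIV (\<lambda>x. c i * f i x)" if "i \<in> I" for i
    using assms(2)[OF that] by (intro continuous_intros)
  have "ip (\<lambda>x. \<Sum>i\<in>I. c i * f i x) (f j) = ip (\<lambda>x. 0) (f j)"
    using 0 c assms(2)[OF j] by (intro ip_cong_AE continuous_on_sum) auto
  also have "\<dots> = 0" by (simp add: ip_def)
  finally have "(\<Sum>i\<in>I. c i * ip (f i) (f j)) = 0"
    using c assms(2)[OF j] by (simp add: ip_sum_left ip_scale_left)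
  moreover have "(\<Sum>i\<in>I. c i * ip (f i) (f j)) = (\<Sum>i\<in>I. if i = j then c i else 0)"
    using orth j by (intro sum.cong) auto
  ultimately show "c j = 0" using j \<open>finite I\<close> by simp
qed

lemma L2_fun_integrable: "L2_fun M f \<Longrightarrow> integrable M f"
  by (auto simp: L2_fun_def intro: square_integrable_imp_integrable)

lemma continuous_L2_fun:
  assumes "continuous_on UNIV f"
  shows "L2_fun M f"
proof -
  have "continuous_on UNIV (\<lambda>x. (f x)\<^sup>2)" using assms by (intro continuous_intros)
  then show ?thesis
    using continuous_measurable[OF assms] continuous_integrable by (auto simp: L2_fun_def)
qed

text \<open>The representative is \<open>op K g / \<mu>\<close>: the operator produces continuous
  functions and does not see changes of \<open>g\<close> on null sets. This links the L2 eigenspaces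
  of the statement to the continuous setting.\<close>

lemma eigenspace_continuous_representative:
  assumes K: "continuous_kernel K" and g: "g \<in> eigenspace M K \<mu>" and "\<mu> \<noteq> 0"
  obtains g' where "continuous_on UNIV g'" "AE x in M. g x = g' x" "op K g' = (\<lambda>x. \<mu> * g' x)"
proof
  define g' where "g' = (\<lambda>x. op K g x / \<mu>)"
  have L2: "L2_fun M g" and ae: "AE x in M. op K g x = \<mu> * g x"
    using g by (auto simp: eigenspace_def)
  have i: "integrable M g" using L2 by (rule L2_fun_integrable)
  show c: "continuous_on UNIV g'"
    unfolding g'_def using op_continuous[OF K i] \<open>\<mu> \<noteq> 0\<close> by (intro continuous_intros) auto
  show ae': "AE x in M. g x = g' x"
    using ae by eventually_elim (use \<open>\<mu> \<noteq> 0\<close> in \<open>simp add: g'_def\<close>)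
  show "op K g' = (\<lambda>x. \<mu> * g' x)"
  proof
    fix x
    have "op K g x = op K g' x"
      using ae' L2 by (intro op_cong_AE[OF K _ continuous_measurable[OF c]]) (auto simp: L2_fun_def)
    moreover have "op K g x = \<mu> * g' x" using \<open>\<mu> \<noteq> 0\<close> by (simp add: g'_def)
    ultimately show "op K g' x = \<mu> * g' x" by (rule trans[OF sym])
  qed
qed

text \<open>Multiplicity is accounted for by counting independent eigenfunctions, whose eigenvalues
  may coincide.\<close>

definition eigenvalue_count_le :: "('a \<Rightarrow> 'a \<Rightarrow> real) \<Rightarrow> real \<Rightarrow> nat \<Rightarrow> bool" where
  "eigenvalue_count_le K l N \<longleftrightarrow> (\<forall>(I :: nat set) f \<mu>. finite I \<longrightarrow>
     (\<forall>i\<in>I. continuous_on UNIV (f i) \<and> op K (f i) = (\<lambda>x. \<mu> i * f i x) \<and> l \<le> \<mu> i) \<longrightarrow>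
     AE_independent I f \<longrightarrow> card I \<le> N)"

text \<open>The strict gap between error and level lets the preceding estimate be read
  contrapositively, as a count.\<close>

lemma eigenvalue_count_le_rank:
  assumes K: "continuous_kernel K" and sym: "\<And>x y. K x y = K y x"
    and G: "continuous_kernel G"
    and \<phi>: "finite A" "\<And>a. a \<in> A \<Longrightarrow> continuous_on UNIV (\<phi> a)"
      "\<And>x. \<exists>b. \<forall>y. G x y = (\<Sum>a\<in>A. b a * \<phi> a y)"
    and close: "\<And>x y. x \<in> D \<Longrightarrow> y \<in> D \<Longrightarrow> \<bar>K x y - G x y\<bar> \<le> \<delta>" and "\<delta> < l"
  shows "eigenvalue_count_le K l (card A)"
  unfolding eigenvalue_count_le_def
proof (intro allI impI, rule ccontr)
  fix I :: "nat set" and f \<mu>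
  assume I: "finite I" "AE_independent I f" "\<not> card I \<le> card A"
    and f: "\<forall>i\<in>I. continuous_on UNIV (f i) \<and> op K (f i) = (\<lambda>x. \<mu> i * f i x) \<and> l \<le> \<mu> i"
  have "l \<le> \<delta>"
    by (rule eigenvalues_le_finite_rank_error[OF K sym G \<phi> close, where I = I and f = f and \<mu> = \<mu>])
      (use I f in auto)
  then show False using \<open>\<delta> < l\<close> by simp
qed

text \<open>The count forces the extracted values to 0, so each nonzero one repeats finitely often.
  The remainder inequality of \<open>spectral_sequence\<close> then puts every eigenfunction into
  the span of the extracted ones with the same value.\<close>

lemma eigenvalue_listing_exists:
  assumes K: "psd_kernel K"
    and count: "\<And>l. l > 0 \<Longrightarrow> \<exists>N. eigenvalue_count_le K l N"
  shows "\<exists>lam. eigenvalue_listing M K lam"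
proof -
  have ck: "continuous_kernel K" and sym: "\<And>x y. K x y = K y x"
    and pos: "\<And>f. continuous_on UNIV f \<Longrightarrow> 0 \<le> ip f (op K f)"
    using K by (auto simp: psd_kernel_def)
  obtain \<mu> :: "nat \<Rightarrow> real" and e :: "nat \<Rightarrow> 'a \<Rightarrow> real" where
    dec: "\<And>n. \<mu> (Suc n) \<le> \<mu> n" and \<mu>0: "\<And>n. 0 \<le> \<mu> n"
    and e: "\<And>n. continuous_on UNIV (e n)"
    and e1: "\<And>n. \<mu> n > 0 \<Longrightarrow> ip (e n) (e n) = 1"
    and orth: "\<And>m n. m \<noteq> n \<Longrightarrow> \<mu> m > 0 \<Longrightarrow> \<mu> n > 0 \<Longrightarrow> ip (e m) (e n) = 0"
    and ope: "\<And>n. \<mu> n > 0 \<Longrightarrow> op K (e n) = (\<lambda>x. \<mu> n * e n x)"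
    and le: "\<And>f n. continuous_on UNIV f \<Longrightarrow>
       ip f (op K f) \<le> \<mu> n * ip f f + (\<Sum>i<n. \<mu> i * (ip (e i) f)\<^sup>2)"
    using spectral_sequence[OF K] by blast
  have anti: "i \<le> j \<Longrightarrow> \<mu> j \<le> \<mu> i" for i j
    using dec by (rule lift_Suc_antimono_le)
  \<comment> \<open>If no value fell below \<open>l\<close>, the first \<open>N + 1\<close>
    extracted functions would be independent and exceed the count.\<close>
  have small: "\<exists>n. \<mu> n < l" if "l > 0" for l
  proof (rule ccontr)
    assume "\<not> ?thesis"
    then have ge: "l \<le> \<mu> n" for n by (simp add: not_less)
    obtain N where N: "eigenvalue_count_le K l N" using count[OF \<open>l > 0\<close>] by blast
    have p: "\<mu> n > 0" for n using ge[of n] \<open>l > 0\<close> by simp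
    have "AE_independent {..N} e"
      using e e1 orth p by (intro AE_independent_orthonormal) auto
    then have "card {..N} \<le> N"
      using N e ope[OF p] ge unfolding eigenvalue_count_le_def by blast
    then show False by simp
  qed
  \<comment> \<open>The extracted sequence starts at 0, the listing at 1.\<close>
  define lam where "lam = (\<lambda>s. \<mu> (s - 1))"
  have "finite {s. 1 \<le> s \<and> lam s = m} \<and>
      has_dim_AE M (eigenspace M K m) (card {s. 1 \<le> s \<and> lam s = m})" if m: "m \<noteq> 0" for m
  proof -
    define T where "T = {i. \<mu> i = m}"
    have S: "{s. 1 \<le> s \<and> lam s = m} = Suc ` T"
    proof (intro equalityI subsetI)
      fix s assume "s \<in> {s. 1 \<le> s \<and> lam s = m}"
      then have "s = Suc (s - 1)" "s - 1 \<in> T" by (auto simp: T_def lam_def)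
      then show "s \<in> Suc ` T" by (rule image_eqI)
    qed (auto simp: T_def lam_def)
    have posT: "m > 0" if "i \<in> T" for i using \<mu>0[of i] m that by (auto simp: T_def)
    have finT: "finite T"
    proof (cases "m > 0")
      case True
      obtain n where n: "\<mu> n < m" using small[OF True] by blast
      have "T \<subseteq> {..n}"
      proof
        fix i assume "i \<in> T"
        then show "i \<in> {..n}" using anti[of n i] n by (cases "n \<le> i") (auto simp: T_def)
      qed
      then show ?thesis using finite_subset by blast
    next
      case False
      then have "T = {}" using posT by blast
      then show ?thesis by simp
    qed
    obtain h where h: "bij_betw h {..<card T} T"
      using ex_bij_betw_nat_finite[OF finT] by (auto simp: atLeast0LessThan)
    have hT: "h i \<in> T" if "i < card T" for i using h that by (auto simp: bij_betw_def)
    have \<mu>T: "\<mu> i = m" "\<mu> i > 0" if "i \<in> T" for i using that posT by (auto simp: T_def)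
    have "has_dim_AE M (eigenspace M K m) (card T)"
      unfolding has_dim_AE_def
    proof (intro exI[of _ "\<lambda>i. e (h i)"] conjI allI ballI)
      show "i < card T \<longrightarrow> e (h i) \<in> eigenspace M K m" for i
        using continuous_L2_fun[OF e, of "h i"] ope[of "h i"] \<mu>T[of "h i"] hT[of i]
        by (auto simp: eigenspace_def)
      have "AE_independent {..<card T} (\<lambda>i. e (h i))"
      proof (rule AE_independent_orthonormal)
        fix i j assume ij: "i \<in> {..<card T}" "j \<in> {..<card T}"
        then have "h i = h j \<longleftrightarrow> i = j" using h by (auto simp: bij_betw_def inj_on_def)
        then show "ip (e (h i)) (e (h j)) = (if i = j then 1 else 0)"
          using ij e1[of "h i"] orth[of "h i" "h j"] \<mu>T(2)[OF hT] by auto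
      qed (use e in auto)
      then show "(AE x in M. (\<Sum>i<card T. c i * e (h i) x) = 0) \<longrightarrow> (\<forall>i<card T. c i = 0)" for c
        unfolding AE_independent_def by auto
    next
      fix g assume g: "g \<in> eigenspace M K m"
      obtain g' where rep: "continuous_on UNIV g'" "AE x in M. g x = g' x"
        "op K g' = (\<lambda>x. m * g' x)"
        using eigenspace_continuous_representative[OF ck g m] by blast
      \<comment> \<open>The remainder is again an eigenfunction for \<open>m\<close> and is
        orthogonal to every \<open>e i\<close> of positive value. For positive \<open>m\<close>, the
        form bound at some \<open>\<mu> n < m\<close> then leaves it no norm.\<close>
      define r where "r = (\<lambda>x. g' x - (\<Sum>i\<in>T. ip (e i) g' * e i x))"
      have ce: "continuous_on UNIV (\<lambda>x. ip (e i) g' * e i x)" for i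
        using e by (intro continuous_intros)
      have cs: "continuous_on UNIV (\<lambda>x. \<Sum>i\<in>T. ip (e i) g' * e i x)"
        using ce by (intro continuous_on_sum)
      have r: "continuous_on UNIV r" unfolding r_def using rep(1) cs by (rule continuous_on_diff)
      have opr: "op K r = (\<lambda>x. m * r x)"
      proof
        fix x
        have "op K r x = op K g' x - (\<Sum>i\<in>T. ip (e i) g' * op K (e i) x)"
          unfolding r_def using rep(1) cs ce e
          by (simp add: op_diff[OF ck] op_sum[OF ck] op_scale continuous_integrable)
        also have "\<dots> = m * g' x - (\<Sum>i\<in>T. ip (e i) g' * (m * e i x))"
          using rep(3) ope \<mu>T by simp
        finally show "op K r x = m * r x"
          by (simp add: r_def algebra_simps sum_distrib_left)
      qed
      have re: "ip (e i) r = 0" if "\<mu> i > 0" for i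
      proof (cases "i \<in> T")
        case True
        have "ip (e i) r = ip (e i) g' - (\<Sum>j\<in>T. ip (e j) g' * ip (e i) (e j))"
          unfolding r_def using rep(1) cs ce e by (simp add: ip_diff_right ip_sum_right ip_scale_right)
        also have "(\<Sum>j\<in>T. ip (e j) g' * ip (e i) (e j)) = (\<Sum>j\<in>T. if j = i then ip (e i) g' else 0)"
          using orth[of i] e1 \<mu>T True by (intro sum.cong) auto
        finally show ?thesis using finT True by simp
      next
        case False
        then show ?thesis
          by (intro eigenfunctions_orthogonal[OF ck sym e ope[OF that] r opr]) (auto simp: T_def)
      qed
      have form: "ip r (op K r) = m * ip r r" by (simp add: opr ip_scale_right)
      have "ip r r = 0"
      proof (cases "m > 0")
        case True
        then obtain n where n: "\<mu> n < m" using small by blast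
        have "\<mu> i * (ip (e i) r)\<^sup>2 = 0" for i
          using re[of i] \<mu>0[of i] by (cases "\<mu> i = 0") auto
        then have "(\<Sum>i<n. \<mu> i * (ip (e i) r)\<^sup>2) = 0" by (intro sum.neutral) blast
        then have "m * ip r r \<le> \<mu> n * ip r r" using le[OF r, of n] by (simp add: form)
        then have "(m - \<mu> n) * ip r r \<le> 0" by (simp add: algebra_simps)
        then show ?thesis using n ip_nonneg[of r] by (simp add: mult_le_0_iff)
      next
        \<comment> \<open>Here \<open>m\<close> is negative and positivity of the form forces
          \<open>r\<close> to vanish; \<open>T\<close> is empty, so the dimension is 0.\<close>
        case False
        then show ?thesis using pos[OF r] ip_nonneg[of r] m by (simp add: form zero_le_mult_iff)
      qed
      then have "AE x in M. r x = 0" using ip_eq_0_iff[OF r] by simp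
      with rep(2) have "AE x in M. g x = (\<Sum>i<card T. ip (e (h i)) g' * e (h i) x)"
      proof eventually_elim
        case (elim x)
        then have "g x = (\<Sum>i\<in>T. ip (e i) g' * e i x)" by (simp add: r_def)
        then show ?case using sum.reindex_bij_betw[OF h, of "\<lambda>i. ip (e i) g' * e i x"] by simp
      qed
      then show "\<exists>c. AE x in M. g x = (\<Sum>i<card T. c i * e (h i) x)"
        by (rule exI[of _ "\<lambda>i. ip (e (h i)) g'"])
    qed
    then show ?thesis unfolding S using finT by (simp add: card_image)
  qed
  moreover have "lam (Suc s) \<le> lam s \<and> 0 \<le> lam s" if "s \<ge> 1" for s
    using anti[of "s - 1" s] \<mu>0 by (simp add: lam_def)
  ultimately show ?thesis unfolding eigenvalue_listing_def by blast
qed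

text \<open>The basis is reindexed by \<open>S\<close>, later the set of positions at which a
  listing takes the value \<open>\<mu>\<close>, so that the bases for different eigenvalues fit
  together into one family over positions.\<close>

lemma has_dim_AE_eigenspace_continuous_basis:
  assumes K: "continuous_kernel K" and "\<mu> \<noteq> 0" "finite S"
    and dim: "has_dim_AE M (eigenspace M K \<mu>) (card S)"
  obtains F where "\<And>t. t \<in> S \<Longrightarrow> continuous_on UNIV (F t)"
    "\<And>t. t \<in> S \<Longrightarrow> op K (F t) = (\<lambda>x. \<mu> * F t x)" "AE_independent S F"
proof -
  obtain f where f: "\<And>i. i < card S \<Longrightarrow> f i \<in> eigenspace M K \<mu>"
    "\<And>c. (AE x in M. (\<Sum>i<card S. c i * f i x) = 0) \<Longrightarrow> \<forall>i<card S. c i = 0"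
    using dim unfolding has_dim_AE_def by blast
  obtain h where h: "bij_betw h {..<card S} S"
    using ex_bij_betw_nat_finite[OF \<open>finite S\<close>] by (auto simp: atLeast0LessThan)
  define k where "k = the_inv_into {..<card S} h"
  have k: "bij_betw k S {..<card S}" unfolding k_def using h by (rule bij_betw_the_inv_into)
  have kS: "k t < card S" if "t \<in> S" for t using k that by (auto simp: bij_betw_def)
  have hk: "h (k t) = t" if "t \<in> S" for t
    using h that by (auto simp: k_def bij_betw_def f_the_inv_into_f)
  have kh: "k (h i) = i" if "i < card S" for i
    using h that by (auto simp: k_def bij_betw_def the_inv_into_f_f)
  have "\<exists>g. continuous_on UNIV g \<and> (AE x in M. f (k t) x = g x) \<and> op K g = (\<lambda>x. \<mu> * g x)"
    if "t \<in> S" for t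
    using eigenspace_continuous_representative[OF K f(1)[OF kS[OF that]] \<open>\<mu> \<noteq> 0\<close>] by blast
  then obtain F where rep: "\<And>t. t \<in> S \<Longrightarrow> continuous_on UNIV (F t)"
    "\<And>t. t \<in> S \<Longrightarrow> AE x in M. f (k t) x = F t x"
    "\<And>t. t \<in> S \<Longrightarrow> op K (F t) = (\<lambda>x. \<mu> * F t x)" by metis
  have "AE_independent S F"
    unfolding AE_independent_def
  proof (intro allI impI ballI)
    fix c t assume 0: "AE x in M. (\<Sum>t\<in>S. c t * F t x) = 0" and t: "t \<in> S"
    have "AE x in M. \<forall>t\<in>S. f (k t) x = F t x"
      using rep(2) \<open>finite S\<close> by (simp add: AE_finite_all)
    with 0 have "AE x in M. (\<Sum>i<card S. c (h i) * f i x) = 0"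
    proof eventually_elim
      case (elim x)
      have "(\<Sum>i<card S. c (h i) * f i x) = (\<Sum>i<card S. c (h i) * f (k (h i)) x)"
        using kh by simp
      also have "\<dots> = (\<Sum>t\<in>S. c t * f (k t) x)"
        by (rule sum.reindex_bij_betw[OF h])
      finally show ?case using elim by simp
    qed
    from f(2)[OF this] show "c t = 0" using kS[OF t] hk[OF t] by metis
  qed
  then show ?thesis using that[of F] rep(1,3) by blast
qed

text \<open>The theorem concerns every listing, not only the constructed one. The positions up to
  \<open>s\<close> carry independent eigenfunctions with values at least \<open>l\<close>, and these
  can be counted.\<close>

lemma eigenvalue_listing_count:
  assumes K: "continuous_kernel K" and sym: "\<And>x y. K x y = K y x"
    and lam: "eigenvalue_listing M K lam"
    and count: "eigenvalue_count_le K l N" and "l > 0" "s \<ge> 1" "l \<le> lam s"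
  shows "s \<le> N"
proof -
  define S where "S = (\<lambda>\<mu>. {t. 1 \<le> t \<and> lam t = \<mu>})"
  have S: "finite (S \<mu>)" "has_dim_AE M (eigenspace M K \<mu>) (card (S \<mu>))" if "\<mu> \<noteq> 0" for \<mu>
    using lam that by (auto simp: eigenvalue_listing_def S_def)
  have anti: "lam s \<le> lam t" if "1 \<le> t" "t \<le> s" for t
    using \<open>t \<le> s\<close>
  proof (induction rule: dec_induct)
    case (step n)
    then show ?case using lam \<open>1 \<le> t\<close> unfolding eigenvalue_listing_def
      by (meson le_trans order_trans)
  qed simp
  define I where "I = {1..s}"
  have I: "l \<le> lam t" "lam t > 0" if "t \<in> I" for t
    using anti[of t] that \<open>l \<le> lam s\<close> \<open>l > 0\<close> by (auto simp: I_def)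
  have "\<exists>F. (\<forall>t\<in>S \<mu>. continuous_on UNIV (F t) \<and> op K (F t) = (\<lambda>x. \<mu> * F t x)) \<and>
      AE_independent (S \<mu>) F" if "\<mu> \<noteq> 0" for \<mu>
    using has_dim_AE_eigenspace_continuous_basis[OF K that S[OF that]] by metis
  then obtain G where G: "\<And>\<mu> t. \<mu> \<noteq> 0 \<Longrightarrow> t \<in> S \<mu> \<Longrightarrow> continuous_on UNIV (G \<mu> t)"
    "\<And>\<mu> t. \<mu> \<noteq> 0 \<Longrightarrow> t \<in> S \<mu> \<Longrightarrow> op K (G \<mu> t) = (\<lambda>x. \<mu> * G \<mu> t x)"
    "\<And>\<mu>. \<mu> \<noteq> 0 \<Longrightarrow> AE_independent (S \<mu>) (G \<mu>)" by metis
  define f where "f = (\<lambda>t. G (lam t) t)"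
  have f: "continuous_on UNIV (f t)" "op K (f t) = (\<lambda>x. lam t * f t x)" if "t \<in> I" for t
    using G I(2)[OF that] that by (auto simp: f_def S_def I_def)
  have "AE_independent I f"
    unfolding AE_independent_def
  proof (intro allI impI ballI)
    fix c t0 assume 0: "AE x in M. (\<Sum>t\<in>I. c t * f t x) = 0" and t0: "t0 \<in> I"
    define \<mu> where "\<mu> = lam t0"
    have \<mu>: "\<mu> \<noteq> 0" using I(2)[OF t0] by (simp add: \<mu>_def)
    define J where "J = {t\<in>I. lam t = \<mu>}"
    have J: "J \<subseteq> S \<mu>" "J \<subseteq> I" "finite J" by (auto simp: J_def S_def I_def)
    \<comment> \<open>The part of the vanishing combination that belongs to one eigenvalue is
      orthogonal to all other parts, hence to itself.\<close>
    define g where "g = (\<lambda>x. \<Sum>t\<in>J. c t * f t x)"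
    have cf: "continuous_on UNIV (\<lambda>x. c t * f t x)" if "t \<in> I" for t
      using f(1)[OF that] by (intro continuous_intros)
    have cg: "continuous_on UNIV g"
      unfolding g_def using cf J by (intro continuous_on_sum) auto
    have opg: "op K g = (\<lambda>x. \<mu> * g x)"
    proof
      fix x
      have "op K g x = (\<Sum>t\<in>J. c t * op K (f t) x)"
        unfolding g_def using f(1) cf J
        by (subst op_sum[OF K]) (auto simp: op_scale intro!: continuous_integrable)
      also have "\<dots> = (\<Sum>t\<in>J. c t * (\<mu> * f t x))"
        using f(2) by (intro sum.cong) (auto simp: J_def)
      finally show "op K g x = \<mu> * g x" by (simp add: g_def sum_distrib_left mult_ac)
    qed
    have "0 = ip (\<lambda>x. 0) g" by (simp add: ip_def)
    also have "\<dots> = ip (\<lambda>x. \<Sum>t\<in>I. c t * f t x) g"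
      using 0 cf cg by (intro ip_cong_AE continuous_on_sum) auto
    also have "\<dots> = (\<Sum>t\<in>I. c t * ip (f t) g)"
      using cf cg by (simp add: ip_sum_left ip_scale_left)
    also have "\<dots> = (\<Sum>t\<in>J. c t * ip (f t) g)"
    proof (rule sum.mono_neutral_right)
      show "\<forall>t\<in>I - J. c t * ip (f t) g = 0"
        using eigenfunctions_orthogonal[OF K sym f cg opg] by (auto simp: J_def)
    qed (use J in \<open>auto simp: I_def\<close>)
    also have "\<dots> = ip g g"
      using f(1) cf cg J by (subst (2) g_def, subst ip_sum_left) (auto simp: ip_scale_left)
    finally have "AE x in M. g x = 0" using ip_eq_0_iff[OF cg] by simp
    \<comment> \<open>The positions with value \<open>\<mu>\<close> may extend beyond
      \<open>s\<close>, whereas independence is known for all of them; missing coefficients are set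
      to 0.\<close>
    moreover have "g x = (\<Sum>t\<in>S \<mu>. (if t \<in> I then c t else 0) * G \<mu> t x)" for x
      unfolding g_def using J S(1)[OF \<mu>]
      by (intro sum.mono_neutral_cong_left) (auto simp: J_def S_def f_def)
    ultimately have "AE x in M. (\<Sum>t\<in>S \<mu>. (if t \<in> I then c t else 0) * G \<mu> t x) = 0" by simp
    then have "\<forall>t\<in>S \<mu>. (if t \<in> I then c t else 0) = 0"
      by (rule mp[OF spec[OF G(3)[OF \<mu>, unfolded AE_independent_def]]])
    then show "c t0 = 0" using t0 by (auto simp: S_def \<mu>_def I_def)
  qed
  then have "card I \<le> N"
    using count f I(1) unfolding eigenvalue_count_le_def by (metis I_def finite_atLeastAtMost)
  then show ?thesis by (simp add: I_def)
qed

end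

section \<open>Power series kernels\<close>

text \<open>Termwise integration of the binomial series of the derivative; both sides agree at 0.
  Here \<open>b\<close> lists the coefficients of the derivative.\<close>

lemma arcsin_power_series:
  obtains c :: "nat \<Rightarrow> real" where "\<And>d. c d \<ge> 0"
    "\<And>t. \<bar>t\<bar> < 1 \<Longrightarrow> (\<lambda>d. c d * t ^ d) sums arcsin t"
proof -
  define b :: "nat \<Rightarrow> real" where
    "b = (\<lambda>n. if even n then (-1) ^ (n div 2) * ((-1/2) gchoose (n div 2)) else 0)"
  \<comment> \<open>At \<open>n = 0\<close> this is a division by zero, so \<open>c 0 = 0\<close>,
    as the antiderivative vanishing at 0 requires.\<close>
  define c where "c = (\<lambda>n. b (n - 1) / of_nat n)"
  \<comment> \<open>The sign cancels against that of the binomial coefficient, leaving a Pochhammer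
    symbol of 1/2 over a factorial.\<close>
  have b0: "b n \<ge> 0" for n
    by (auto simp: b_def gbinomial_pochhammer power_add[symmetric] intro!: pochhammer_nonneg divide_nonneg_pos)
  have c0: "c n \<ge> 0" for n using b0 by (simp add: c_def)
  have b_sums: "(\<lambda>n. b n * t ^ n) sums inverse (sqrt (1 - t\<^sup>2))" if t: "\<bar>t\<bar> < 1" for t
  proof -
    have t2: "t\<^sup>2 < 1" using t by (simp add: abs_square_less_1)
    then have "(\<lambda>n. ((-1/2) gchoose n) * (- (t\<^sup>2)) ^ n) sums (1 + - (t\<^sup>2)) powr (-1/2)"
      by (intro gen_binomial_real) simp
    moreover have "(1 + - (t\<^sup>2)) powr (-1/2) = inverse (sqrt (1 - t\<^sup>2))"
      using t2 powr_minus[of "1 - t\<^sup>2" "1/2"] by (simp add: powr_half_sqrt)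
    moreover have "((-1/2) gchoose n) * (- (t\<^sup>2)) ^ n = b (2 * n) * t ^ (2 * n)" for n
      by (simp add: b_def power_mult power_minus[of "t\<^sup>2"])
    ultimately have "(\<lambda>n. b (2 * n) * t ^ (2 * n)) sums inverse (sqrt (1 - t\<^sup>2))" by simp
    moreover have "strict_mono (\<lambda>n::nat. 2 * n)" by (simp add: strict_mono_def)
    moreover have "b n * t ^ n = 0" if "n \<notin> range (\<lambda>n::nat. 2 * n)" for n
      using that by (auto simp: b_def elim!: evenE)
    ultimately show ?thesis
      using sums_mono_reindex[of "\<lambda>n::nat. 2 * n" "\<lambda>n. b n * t ^ n"] by simp
  qed
  have c_summable: "summable (\<lambda>n. c n * t ^ n)" if t: "\<bar>t\<bar> < 1" for t
  proof -
    have "summable (\<lambda>n. c (Suc n) * t ^ Suc n)"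
    proof (rule summable_comparison_test')
      show "summable (\<lambda>n. b n * \<bar>t\<bar> ^ n)"
        using b_sums[of "\<bar>t\<bar>"] t sums_summable by auto
      show "norm (c (Suc n) * t ^ Suc n) \<le> b n * \<bar>t\<bar> ^ n" for n
      proof -
        have "norm (c (Suc n) * t ^ Suc n) = (\<bar>t\<bar> / Suc n) * (b n * \<bar>t\<bar> ^ n)"
          using b0[of n] by (simp add: c_def abs_mult power_abs)
        also have "\<dots> \<le> 1 * (b n * \<bar>t\<bar> ^ n)"
          using t b0[of n] by (intro mult_right_mono) auto
        finally show ?thesis by simp
      qed
    qed
    then show ?thesis using summable_Suc_iff[of "\<lambda>n. c n * t ^ n"] by blast
  qed
  define F where "F = (\<lambda>t. \<Sum>n. c n * t ^ n)"
  have dF: "(F has_real_derivative inverse (sqrt (1 - t\<^sup>2))) (at t)" if t: "\<bar>t\<bar> < 1" for t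
  proof -
    have "(F has_real_derivative (\<Sum>n. diffs c n * t ^ n)) (at t)"
      unfolding F_def by (rule termdiffs_strong'[where K = 1]) (use c_summable t in auto)
    moreover have "diffs c = b" by (simp add: diffs_def c_def fun_eq_iff)
    ultimately show ?thesis using b_sums[OF t] by (simp add: sums_iff)
  qed
  have "F t = arcsin t" if t: "\<bar>t\<bar> < 1" for t
  proof -
    have "(\<lambda>t. F t - arcsin t) t = (\<lambda>t. F t - arcsin t) 0"
    proof (rule DERIV_isconst3[where a = "-1" and b = 1 and f = "\<lambda>t. F t - arcsin t"])
      fix x :: real assume "x \<in> {-1<..<1}"
      then show "((\<lambda>t. F t - arcsin t) has_real_derivative 0) (at x)"
        by (auto intro!: derivative_eq_intros dF)
    qed (use t in auto)
    moreover have "F 0 = c 0" unfolding F_def by (rule powser_zero)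
    then have "F 0 = 0" by (simp add: c_def)
    ultimately show ?thesis by simp
  qed
  then show ?thesis
    using that[of c] c0 c_summable by (metis F_def summable_sums)
qed

text \<open>An intermediate radius \<open>p'\<close> gives a geometric rate from convergence alone:
  in degrees at least \<open>n\<close>, passing from \<open>p'\<close> to \<open>p\<close> gains the
  factor \<open>(p / p') ^ n\<close>, and the remaining series is at most
  \<open>F p'\<close>.\<close>

lemma power_series_tail_le:
  fixes c :: "nat \<Rightarrow> real"
  assumes c: "\<And>d. c d \<ge> 0" and F: "\<And>t. \<bar>t\<bar> < 1 \<Longrightarrow> (\<lambda>d. c d * t ^ d) sums F t"
    and p: "\<bar>t\<bar> \<le> p" "p < p'" "p' < 1"
  shows "\<bar>F t - (\<Sum>d<n. c d * t ^ d)\<bar> \<le> F p' * (p / p') ^ n"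
proof -
  have p': "0 < p'" "0 \<le> p" using p by linarith+
  have le: "\<bar>c (d + n) * t ^ (d + n)\<bar> \<le> (c (d + n) * p' ^ (d + n)) * (p / p') ^ n" for d
  proof -
    have "\<bar>c (d + n) * t ^ (d + n)\<bar> = c (d + n) * \<bar>t\<bar> ^ d * \<bar>t\<bar> ^ n"
      using c by (simp add: abs_mult power_abs power_add)
    also have "\<dots> \<le> c (d + n) * p' ^ d * p ^ n"
      using p p' c by (intro mult_mono power_mono mult_nonneg_nonneg) auto
    also have "\<dots> = (c (d + n) * p' ^ (d + n)) * (p / p') ^ n"
      using p' by (simp add: power_add power_divide)
    finally show ?thesis .
  qed
  have s1: "(\<lambda>d. c (d + n) * t ^ (d + n)) sums (F t - (\<Sum>d<n. c d * t ^ d))"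
    using p by (intro sums_split_initial_segment F) auto
  have s2: "(\<lambda>d. c (d + n) * p' ^ (d + n)) sums (F p' - (\<Sum>d<n. c d * p' ^ d))"
    using p p' by (intro sums_split_initial_segment F) auto
  from s2 have s3: "(\<lambda>d. (c (d + n) * p' ^ (d + n)) * (p / p') ^ n) sums
      ((F p' - (\<Sum>d<n. c d * p' ^ d)) * (p / p') ^ n)"
    by (rule sums_mult2)
  have "F t - (\<Sum>d<n. c d * t ^ d) \<le> (F p' - (\<Sum>d<n. c d * p' ^ d)) * (p / p') ^ n"
    using le by (intro sums_le[OF _ s1 s3]) (auto simp: abs_le_iff)
  moreover have "- (F t - (\<Sum>d<n. c d * t ^ d)) \<le> (F p' - (\<Sum>d<n. c d * p' ^ d)) * (p / p') ^ n"
    using le by (intro sums_le[OF _ sums_minus[OF s1] s3]) (auto simp: abs_le_iff)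
  moreover have "(F p' - (\<Sum>d<n. c d * p' ^ d)) * (p / p') ^ n \<le> F p' * (p / p') ^ n"
    using p' c by (intro mult_right_mono) (auto intro!: sum_nonneg)
  ultimately show ?thesis by linarith
qed

lemma power_series_continuous_on:
  fixes c :: "nat \<Rightarrow> real"
  assumes F: "\<And>t. \<bar>t\<bar> < 1 \<Longrightarrow> (\<lambda>d. c d * t ^ d) sums F t"
  shows "continuous_on {-1<..<1} F"
proof -
  have "continuous_on {-1<..<1} (\<lambda>t. \<Sum>d. c d * t ^ d)"
  proof (rule continuous_at_imp_continuous_on, rule ballI)
    fix t :: real assume t: "t \<in> {-1<..<1}"
    have "((\<lambda>t. \<Sum>d. c d * t ^ d) has_real_derivative (\<Sum>d. diffs c d * t ^ d)) (at t)"
      by (rule termdiffs_strong'[where K = 1]) (use F sums_summable t in auto)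
    then show "isCont (\<lambda>t. \<Sum>d. c d * t ^ d) t" by (rule DERIV_isCont)
  qed
  then show ?thesis
    by (rule continuous_on_eq) (use F in \<open>auto simp: sums_iff\<close>)
qed

text \<open>The factor \<open>u\<^sub>0\<close> occurs at most once: its square is a quadratic polynomial in the
  remaining \<open>u i\<close>, so only these contribute to the growth of the number of monomials.\<close>

definition monomial :: "('x \<Rightarrow> real) \<Rightarrow> ('i::finite \<Rightarrow> 'x \<Rightarrow> real) \<Rightarrow> bool \<times> ('i \<Rightarrow> nat) \<Rightarrow> 'x \<Rightarrow> real" where
  "monomial u\<^sub>0 u a x = (if fst a then u\<^sub>0 x else 1) * (\<Prod>i\<in>UNIV. u i x ^ snd a i)"

text \<open>A box of exponents instead of a bound on the total degree: the cardinality is immediate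
  and of the same order in \<open>n\<close>. The boolean marks the presence of
  \<open>u\<^sub>0\<close>.\<close>

definition exponents :: "nat \<Rightarrow> (bool \<times> ('i::finite \<Rightarrow> nat)) set" where
  "exponents n = UNIV \<times> {\<alpha>. \<forall>i. \<alpha> i \<le> n}"

lemma finite_exponents: "finite (exponents n :: (bool \<times> ('i::finite \<Rightarrow> nat)) set)"
  and card_exponents:
    "card (exponents n :: (bool \<times> ('i::finite \<Rightarrow> nat)) set) = 2 * (n + 1) ^ CARD('i)"
proof -
  have *: "{\<alpha>. \<forall>i. \<alpha> i \<le> n} = (\<Pi>\<^sub>E i\<in>(UNIV :: 'i set). {..n})" by (auto simp: PiE_UNIV_domain)
  show "finite (exponents n :: (bool \<times> ('i::finite \<Rightarrow> nat)) set)"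
    unfolding exponents_def * by (auto intro!: finite_PiE)
  show "card (exponents n :: (bool \<times> ('i::finite \<Rightarrow> nat)) set) = 2 * (n + 1) ^ CARD('i)"
    unfolding exponents_def * by (simp add: card_cartesian_product card_PiE)
qed

section \<open>Spans of monomials restricted to a quadric\<close>

definition monomial_span ::
  "('x \<Rightarrow> real) \<Rightarrow> ('i::finite \<Rightarrow> 'x \<Rightarrow> real) \<Rightarrow> nat \<Rightarrow> ('x \<Rightarrow> real) set" where
  "monomial_span u\<^sub>0 u n = {p. \<exists>b. \<forall>x. p x = (\<Sum>a\<in>exponents n. b a * monomial u\<^sub>0 u a x)}"

lemma monomial_span_base: "a \<in> exponents n \<Longrightarrow> monomial u\<^sub>0 u a \<in> monomial_span u\<^sub>0 u n"
  unfolding monomial_span_def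
  by (auto intro!: exI[of _ "\<lambda>a'. if a' = a then 1 else 0"]
      simp: if_distrib[of "\<lambda>r. r * _"] finite_exponents cong: if_cong)

lemma monomial_span_add:
  assumes "p \<in> monomial_span u\<^sub>0 u n" "q \<in> monomial_span u\<^sub>0 u n"
  shows "(\<lambda>x. p x + q x) \<in> monomial_span u\<^sub>0 u n"
proof -
  obtain b b' where "\<forall>x. p x = (\<Sum>a\<in>exponents n. b a * monomial u\<^sub>0 u a x)"
    "\<forall>x. q x = (\<Sum>a\<in>exponents n. b' a * monomial u\<^sub>0 u a x)"
    using assms unfolding monomial_span_def by blast
  then show ?thesis unfolding monomial_span_def
    by (auto intro!: exI[of _ "\<lambda>a. b a + b' a"] simp: sum.distrib ring_distribs)
qed

lemma monomial_span_scale: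
  assumes "p \<in> monomial_span u\<^sub>0 u n"
  shows "(\<lambda>x. s * p x) \<in> monomial_span u\<^sub>0 u n"
proof -
  obtain b where "\<forall>x. p x = (\<Sum>a\<in>exponents n. b a * monomial u\<^sub>0 u a x)"
    using assms unfolding monomial_span_def by blast
  then show ?thesis unfolding monomial_span_def
    by (auto intro!: exI[of _ "\<lambda>a. s * b a"] simp: sum_distrib_left mult.assoc)
qed

lemma monomial_span_zero: "(\<lambda>x. 0) \<in> monomial_span u\<^sub>0 u n"
  unfolding monomial_span_def by (auto intro!: exI[of _ "\<lambda>_. 0"])

lemma monomial_span_sum:
  assumes "\<And>j. j \<in> J \<Longrightarrow> p j \<in> monomial_span u\<^sub>0 u n"
  shows "(\<lambda>x. \<Sum>j\<in>J. p j x) \<in> monomial_span u\<^sub>0 u n"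
  using assms
  by (induction J rule: infinite_finite_induct)
    (auto intro: monomial_span_zero monomial_span_add)

lemma monomial_span_mult_by_base:
  assumes "p \<in> monomial_span u\<^sub>0 u n"
    and "\<And>a. a \<in> exponents n \<Longrightarrow> (\<lambda>x. w x * monomial u\<^sub>0 u a x) \<in> monomial_span u\<^sub>0 u m"
  shows "(\<lambda>x. w x * p x) \<in> monomial_span u\<^sub>0 u m"
proof -
  obtain b where "\<forall>x. p x = (\<Sum>a\<in>exponents n. b a * monomial u\<^sub>0 u a x)"
    using assms unfolding monomial_span_def by blast
  then have "(\<lambda>x. w x * p x) = (\<lambda>x. \<Sum>a\<in>exponents n. b a * (w x * monomial u\<^sub>0 u a x))"
    by (auto simp: sum_distrib_left mult_ac)
  also have "\<dots> \<in> monomial_span u\<^sub>0 u m"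
    using assms(2) by (intro monomial_span_sum monomial_span_scale)
  finally show ?thesis .
qed

lemma monomial_span_mono:
  fixes u :: "'i::finite \<Rightarrow> 'x \<Rightarrow> real"
  assumes "p \<in> monomial_span u\<^sub>0 u n" "n \<le> m"
  shows "p \<in> monomial_span u\<^sub>0 u m"
proof -
  have "(\<lambda>x. 1 * p x) \<in> monomial_span u\<^sub>0 u m"
  proof (rule monomial_span_mult_by_base[OF assms(1)])
    fix a :: "bool \<times> ('i \<Rightarrow> nat)" assume "a \<in> exponents n"
    then have "a \<in> exponents m" using le_trans[OF _ \<open>n \<le> m\<close>] by (auto simp: exponents_def)
    then show "(\<lambda>x. 1 * monomial u\<^sub>0 u a x) \<in> monomial_span u\<^sub>0 u m"
      using monomial_span_base by simp
  qed
  then show ?thesis by simp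
qed

lemma monomial_mult:
  "u i x ^ k * monomial u\<^sub>0 u a x = monomial u\<^sub>0 u (fst a, (snd a)(i := snd a i + k)) x"
proof -
  have "(\<Prod>j\<in>UNIV. u j x ^ ((snd a)(i := snd a i + k)) j) =
      (\<Prod>j\<in>UNIV. u j x ^ snd a j * (if j = i then u j x ^ k else 1))"
    by (intro prod.cong) (auto simp: power_add)
  also have "\<dots> = (\<Prod>j\<in>UNIV. u j x ^ snd a j) * u i x ^ k"
    by (simp add: prod.distrib)
  finally show ?thesis by (simp add: monomial_def)
qed

lemma monomial_span_mult:
  fixes u :: "'i::finite \<Rightarrow> 'x \<Rightarrow> real"
  assumes "p \<in> monomial_span u\<^sub>0 u n"
  shows "(\<lambda>x. u i x ^ k * p x) \<in> monomial_span u\<^sub>0 u (n + k)"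
  using assms
proof (rule monomial_span_mult_by_base)
  fix a :: "bool \<times> ('i \<Rightarrow> nat)" assume "a \<in> exponents n"
  then have "(fst a, (snd a)(i := snd a i + k)) \<in> exponents (n + k)"
    by (auto simp: exponents_def intro: trans_le_add1)
  then show "(\<lambda>x. u i x ^ k * monomial u\<^sub>0 u a x) \<in> monomial_span u\<^sub>0 u (n + k)"
    unfolding monomial_mult by (rule monomial_span_base)
qed

text \<open>If the factor \<open>u\<^sub>0\<close> is absent it is inserted; if present, its square
  is rewritten by the quadric, which raises an exponent by 2.\<close>

lemma monomial_span_mult_quadric:
  fixes u :: "'i::finite \<Rightarrow> 'x \<Rightarrow> real"
  assumes p: "p \<in> monomial_span u\<^sub>0 u n"
    and quadric: "\<And>x. (u\<^sub>0 x)\<^sup>2 = \<kappa> * (1 - (\<Sum>i\<in>UNIV. (u i x)\<^sup>2))"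
  shows "(\<lambda>x. u\<^sub>0 x * p x) \<in> monomial_span u\<^sub>0 u (n + 2)"
  using p
proof (rule monomial_span_mult_by_base)
  fix a :: "bool \<times> ('i \<Rightarrow> nat)" assume a: "a \<in> exponents n"
  define a' where "a' = (\<not> fst a, snd a)"
  have a': "monomial u\<^sub>0 u a' \<in> monomial_span u\<^sub>0 u n"
    using a by (intro monomial_span_base) (auto simp: exponents_def a'_def)
  show "(\<lambda>x. u\<^sub>0 x * monomial u\<^sub>0 u a x) \<in> monomial_span u\<^sub>0 u (n + 2)"
  proof (cases "fst a")
    case False
    then have "(\<lambda>x. u\<^sub>0 x * monomial u\<^sub>0 u a x) = monomial u\<^sub>0 u a'"
      by (auto simp: monomial_def a'_def)
    then show ?thesis using monomial_span_mono[OF a'] by simp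
  next
    case True
    then have "u\<^sub>0 x * monomial u\<^sub>0 u a x = (u\<^sub>0 x)\<^sup>2 * monomial u\<^sub>0 u a' x" for x
      by (simp add: monomial_def a'_def power2_eq_square)
    then have "(\<lambda>x. u\<^sub>0 x * monomial u\<^sub>0 u a x) = (\<lambda>x. \<kappa> * monomial u\<^sub>0 u a' x +
        (- \<kappa>) * (\<Sum>i\<in>UNIV. u i x ^ 2 * monomial u\<^sub>0 u a' x))"
      by (simp add: quadric right_diff_distrib left_diff_distrib mult.assoc flip: sum_distrib_right)
    also have "\<dots> \<in> monomial_span u\<^sub>0 u (n + 2)"
      using a' by (intro monomial_span_add monomial_span_scale monomial_span_sum
          monomial_span_mult monomial_span_mono[OF a']) auto
    finally show ?thesis .
  qed
qed

text \<open>Every factor costs at most 2 in the exponents, the price of the quadric. The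
  coefficients \<open>v\<^sub>0\<close>, \<open>v\<close> will be the features of the other kernel
  argument.\<close>

lemma monomial_span_inner_power:
  assumes quadric: "\<And>x. (u\<^sub>0 x)\<^sup>2 = \<kappa> * (1 - (\<Sum>i\<in>UNIV. (u i x)\<^sup>2))"
  shows "(\<lambda>x. (v\<^sub>0 * u\<^sub>0 x + (\<Sum>i\<in>UNIV. v i * u i x)) ^ d) \<in> monomial_span u\<^sub>0 u (2 * d)"
proof (induction d)
  case 0
  have "(False, \<lambda>_. 0) \<in> exponents 0" by (simp add: exponents_def)
  from monomial_span_base[OF this, of u\<^sub>0 u] show ?case by (simp add: monomial_def[abs_def])
next
  case (Suc d)
  let ?p = "\<lambda>x. (v\<^sub>0 * u\<^sub>0 x + (\<Sum>i\<in>UNIV. v i * u i x)) ^ d"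
  have "(\<lambda>x. v\<^sub>0 * (u\<^sub>0 x * ?p x) + (\<Sum>i\<in>UNIV. v i * (u i x ^ 1 * ?p x))) \<in> monomial_span u\<^sub>0 u (2 * d + 2)"
  proof (intro monomial_span_add monomial_span_scale monomial_span_sum)
    show "(\<lambda>x. u\<^sub>0 x * ?p x) \<in> monomial_span u\<^sub>0 u (2 * d + 2)"
      using Suc.IH quadric by (rule monomial_span_mult_quadric)
    show "(\<lambda>x. u i x ^ 1 * ?p x) \<in> monomial_span u\<^sub>0 u (2 * d + 2)" for i
      using monomial_span_mult[OF Suc.IH, of i 1] by (rule monomial_span_mono) simp
  qed
  then show ?case by (simp add: sum_distrib_right algebra_simps)
qed

context compact_prob
begin

text \<open>The factor \<open>T\<close> is absorbed into the test function:
  \<open>\<langle>f, (T G) f\<rangle> = \<Sum>j. \<langle>v j f, G (v j f)\<rangle>\<close>.\<close>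

lemma inner_power_kernel_form_nonneg:
  fixes v :: "'j \<Rightarrow> 'a \<Rightarrow> real"
  assumes v: "finite J" "\<And>j. j \<in> J \<Longrightarrow> continuous_on UNIV (v j)"
    and f: "continuous_on UNIV f"
  shows "0 \<le> ip f (op (\<lambda>x y. (\<Sum>j\<in>J. v j x * v j y) ^ d) f)"
  using f
proof (induction d arbitrary: f)
  case 0
  have "ip f (op (\<lambda>x y. 1) f) = (\<integral>x. f x \<partial>M) * (\<integral>x. f x \<partial>M)"
    by (simp add: ip_def integral_operator_def)
  then show ?case by simp
next
  case (Suc d)
  define G where "G = (\<lambda>x y. (\<Sum>j\<in>J. v j x * v j y) ^ d)"
  have cv: "continuous_on UNIV (\<lambda>p::'a \<times> 'a. v j (fst p))" "continuous_on UNIV (\<lambda>p::'a \<times> 'a. v j (snd p))"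
    if "j \<in> J" for j
    by (rule continuous_on_compose2[OF v(2)[OF that]]; simp add: continuous_on_fst continuous_on_snd)+
  have G: "continuous_kernel G"
    unfolding G_def continuous_kernel_def using cv by (intro continuous_intros) auto
  have vf: "continuous_on UNIV (\<lambda>x. v j x * f x)" if "j \<in> J" for j
    using v(2)[OF that] Suc.prems by (intro continuous_intros)
  have opc: "continuous_on UNIV (op G (\<lambda>y. v j y * f y))" if "j \<in> J" for j
    using vf[OF that] G by (intro op_continuous continuous_integrable)
  have "op (\<lambda>x y. (\<Sum>j\<in>J. v j x * v j y) ^ Suc d) f x = (\<Sum>j\<in>J. v j x * op G (\<lambda>y. v j y * f y) x)" for x
  proof -
    have "op (\<lambda>x y. (\<Sum>j\<in>J. v j x * v j y) ^ Suc d) f x =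
        (\<integral>y. (\<Sum>j\<in>J. v j x * (G x y * (v j y * f y))) \<partial>M)"
      unfolding integral_operator_def G_def
      by (intro Bochner_Integration.integral_cong) (auto simp: sum_distrib_right sum_distrib_left mult_ac)
    also have "\<dots> = (\<Sum>j\<in>J. \<integral>y. v j x * (G x y * (v j y * f y)) \<partial>M)"
      using kernel_integrable[OF G continuous_integrable[OF vf]]
      by (intro Bochner_Integration.integral_sum integrable_mult_right)
    finally show ?thesis by (simp add: integral_operator_def)
  qed
  then have "ip f (op (\<lambda>x y. (\<Sum>j\<in>J. v j x * v j y) ^ Suc d) f) =
      ip f (\<lambda>x. \<Sum>j\<in>J. v j x * op G (\<lambda>y. v j y * f y) x)" by presburger
  also have "\<dots> = (\<Sum>j\<in>J. ip f (\<lambda>x. v j x * op G (\<lambda>y. v j y * f y) x))"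
    using v(2) opc Suc.prems by (intro ip_sum_right continuous_on_mult) auto
  also have "\<dots> = (\<Sum>j\<in>J. ip (\<lambda>x. v j x * f x) (op G (\<lambda>y. v j y * f y)))"
    by (simp add: ip_def mult_ac)
  also have "\<dots> \<ge> 0"
    unfolding G_def by (intro sum_nonneg Suc.IH vf)
  finally show ?case .
qed

text \<open>\<open>T\<close> is the inner product of feature vectors. For fixed first argument the
  truncated series is a combination of monomials with exponents up to \<open>2 * n\<close>, whose
  number is the count; compactness of \<open>D\<close> supplies the uniform margin below 1 behind
  the geometric error.\<close>

lemma power_series_kernel:
  fixes u :: "'i::finite \<Rightarrow> 'a \<Rightarrow> real" and c :: "nat \<Rightarrow> real"
  assumes c: "\<And>d. c d \<ge> 0" and F: "\<And>t. \<bar>t\<bar> < 1 \<Longrightarrow> (\<lambda>d. c d * t ^ d) sums F t"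
    and u: "continuous_on UNIV u\<^sub>0" "\<And>i. continuous_on UNIV (u i)"
    and quadric: "\<And>x. (u\<^sub>0 x)\<^sup>2 = \<kappa> * (1 - (\<Sum>i\<in>UNIV. (u i x)\<^sup>2))"
  defines "T \<equiv> \<lambda>x y. u\<^sub>0 x * u\<^sub>0 y + (\<Sum>i\<in>UNIV. u i x * u i y)"
  assumes T: "\<And>x y. \<bar>T x y\<bar> < 1"
  shows "psd_kernel (\<lambda>x y. F (T x y))"
    and "\<exists>C q. 0 < C \<and> 0 < q \<and> q < 1 \<and>
      (\<forall>n. eigenvalue_count_le (\<lambda>x y. F (T x y)) (C * q ^ n) (2 * (2 * n + 1) ^ CARD('i)))"
proof -
  define K where "K = (\<lambda>x y. F (T x y))"
  define G where "G = (\<lambda>n x y. \<Sum>d<n. c d * T x y ^ d)"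
  have cu: "continuous_on UNIV (\<lambda>p::'a \<times> 'a. u i (fst p))" "continuous_on UNIV (\<lambda>p::'a \<times> 'a. u i (snd p))"
    "continuous_on UNIV (\<lambda>p::'a \<times> 'a. u\<^sub>0 (fst p))" "continuous_on UNIV (\<lambda>p::'a \<times> 'a. u\<^sub>0 (snd p))" for i
    by (rule continuous_on_compose2[OF u(2)[of i]] continuous_on_compose2[OF u(1)];
        simp add: continuous_on_fst continuous_on_snd)+
  have cT: "continuous_on UNIV (\<lambda>p. T (fst p) (snd p))"
    unfolding T_def by (intro continuous_intros cu)
  have cG: "continuous_kernel (G n)" for n
    unfolding G_def continuous_kernel_def by (intro continuous_intros cT)
  have cTd: "continuous_kernel (\<lambda>x y. T x y ^ d)" for d
    unfolding continuous_kernel_def by (intro continuous_intros cT)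
  have cK: "continuous_kernel K"
    unfolding K_def continuous_kernel_def
  proof (rule continuous_on_compose2[OF power_series_continuous_on cT])
    have "-1 < T x y \<and> T x y < 1" for x y using T[of x y] by linarith
    then show "range (\<lambda>p. T (fst p) (snd p)) \<subseteq> {-1<..<1}" by auto
  qed (rule F)
  have symT: "T x y = T y x" for x y by (simp add: T_def mult.commute)
  have symK: "K x y = K y x" for x y by (simp add: K_def symT[of x y])
  have "\<exists>z\<in>D \<times> D. \<forall>p\<in>D \<times> D. \<bar>T (fst p) (snd p)\<bar> \<le> \<bar>T (fst z) (snd z)\<bar>"
    using D_nonempty compact_Times[OF compact_D compact_D]
    by (intro continuous_attains_sup continuous_on_rabs continuous_on_subset[OF cT]) auto
  then obtain z where z: "\<And>x y. x \<in> D \<Longrightarrow> y \<in> D \<Longrightarrow> \<bar>T x y\<bar> \<le> \<bar>T (fst z) (snd z)\<bar>" by force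
  \<comment> \<open>Midpoints between the maximum and 1, then between \<open>p\<close> and 1. So
    \<open>p\<close> is positive even if \<open>T\<close> vanishes on \<open>D\<close>, and
    \<open>q\<close> lies strictly between 0 and 1.\<close>
  define p where "p = (\<bar>T (fst z) (snd z)\<bar> + 1) / 2"
  define p' where "p' = (p + 1) / 2"
  have p: "0 < p" "p < p'" "p' < 1" and pT: "\<And>x y. x \<in> D \<Longrightarrow> y \<in> D \<Longrightarrow> \<bar>T x y\<bar> \<le> p"
    using T[of "fst z" "snd z"] z by (force simp: p_def p'_def)+
  define q where "q = p / p'"
  have q: "0 < q" "q < 1" using p by (auto simp: q_def)
  define \<delta> where "\<delta> = (\<lambda>n. F p' * q ^ n)"
  have close: "\<bar>K x y - G n x y\<bar> \<le> \<delta> n" if "x \<in> D" "y \<in> D" for x y n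
    unfolding K_def G_def \<delta>_def q_def
    using c F pT[OF that] p(2,3) by (rule power_series_tail_le)
  have "0 \<le> ip f (op K f)" if f: "continuous_on UNIV f" for f
  proof -
    \<comment> \<open>Truncations have nonnegative forms, so the form of \<open>K\<close> is
      nonnegative up to the truncation error, which tends to 0.\<close>
    have "- (\<delta> n * ip f f) \<le> ip f (op K f)" for n
    proof -
      have "op (G n) f = (\<lambda>x. \<Sum>d<n. c d * op (\<lambda>x y. T x y ^ d) f x)"
      proof
        fix x
        have "op (G n) f x = (\<integral>y. (\<Sum>d<n. c d * (T x y ^ d * f y)) \<partial>M)"
          by (simp add: integral_operator_def G_def sum_distrib_right mult.assoc)
        also have "\<dots> = (\<Sum>d<n. \<integral>y. c d * (T x y ^ d * f y) \<partial>M)"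
          using kernel_integrable[OF cTd continuous_integrable[OF f]]
          by (intro Bochner_Integration.integral_sum integrable_mult_right)
        finally show "op (G n) f x = (\<Sum>d<n. c d * op (\<lambda>x y. T x y ^ d) f x)"
          by (simp add: integral_operator_def)
      qed
      then have "ip f (op (G n) f) = (\<Sum>d<n. c d * ip f (op (\<lambda>x y. T x y ^ d) f))"
        using op_continuous[OF cTd continuous_integrable[OF f]] f
        by (simp add: ip_sum_right[of _ "\<lambda>d x. c d * op (\<lambda>x y. T x y ^ d) f x"] ip_scale_right
            continuous_on_mult continuous_on_const)
      also have "\<dots> \<ge> 0"
      proof (intro sum_nonneg mult_nonneg_nonneg c)
        fix d
        \<comment> \<open>The option type adds \<open>u\<^sub>0\<close> to the family
          \<open>u\<close> as one further feature.\<close>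
        define w where "w = (\<lambda>j. case j of None \<Rightarrow> u\<^sub>0 | Some i \<Rightarrow> u i)"
        have "T x y = (\<Sum>j\<in>UNIV. w j x * w j y)" for x y
          by (simp add: T_def w_def UNIV_option_conv sum.reindex)
        then show "0 \<le> ip f (op (\<lambda>x y. T x y ^ d) f)"
          using inner_power_kernel_form_nonneg[of "UNIV :: 'i option set" w f d] u f
          by (simp add: w_def split: option.split)
      qed
      finally show ?thesis using qform_diff_le[OF cK cG f close, of n] by (simp add: abs_le_iff)
    qed
    moreover have "(\<lambda>n. - (\<delta> n * ip f f)) \<longlonglongrightarrow> - (F p' * 0 * ip f f)"
      unfolding \<delta>_def using q by (intro tendsto_intros LIMSEQ_power_zero) auto
    ultimately show ?thesis by (intro LIMSEQ_le_const2[of _ "- (F p' * 0 * ip f f)", simplified]) auto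
  qed
  then show "psd_kernel (\<lambda>x y. F (T x y))"
    using cK symK unfolding psd_kernel_def K_def by blast
  have "F p' \<ge> 0"
    using sums_le[OF _ sums_zero F[of p']] c p by auto
  \<comment> \<open>The \<open>+ 1\<close> puts the level strictly above the error and makes the
    constant positive.\<close>
  have "eigenvalue_count_le K ((F p' + 1) * q ^ n) (2 * (2 * n + 1) ^ CARD('i))" for n
  proof -
    have "eigenvalue_count_le K ((F p' + 1) * q ^ n)
        (card (exponents (2 * n) :: (bool \<times> ('i \<Rightarrow> nat)) set))"
    proof (rule eigenvalue_count_le_rank[OF cK symK cG[of n] finite_exponents _ _ close])
      show "continuous_on UNIV (monomial u\<^sub>0 u a)" for a
        unfolding monomial_def[abs_def] using u by (cases "fst a") (auto intro!: continuous_intros)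
      show "\<exists>b. \<forall>y. G n x y = (\<Sum>a\<in>exponents (2 * n). b a * monomial u\<^sub>0 u a y)" for x
      proof -
        have "G n x \<in> monomial_span u\<^sub>0 u (2 * n)"
          unfolding G_def T_def
          by (intro monomial_span_sum monomial_span_scale
              monomial_span_mono[OF monomial_span_inner_power[OF quadric]]) auto
        then show ?thesis by (simp add: monomial_span_def)
      qed
      show "\<delta> n < (F p' + 1) * q ^ n" using q by (simp add: \<delta>_def)
    qed
    then show ?thesis by (simp add: card_exponents)
  qed
  then show "\<exists>C q. 0 < C \<and> 0 < q \<and> q < 1 \<and>
      (\<forall>n. eigenvalue_count_le (\<lambda>x y. F (T x y)) (C * q ^ n) (2 * (2 * n + 1) ^ CARD('i)))"
    using q \<open>F p' \<ge> 0\<close> unfolding K_def by (intro exI[of _ "F p' + 1"] exI[of _ q]) auto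
qed

end

section \<open>Stretched exponential decay\<close>

text \<open>For given \<open>s\<close>, \<open>n\<close> is taken as large as
  \<open>2 * (2 * n + 1) ^ m < s\<close> comfortably allows; the count, read contrapositively, gives
  \<open>lam s < C * q ^ n\<close>.\<close>

lemma stretched_exponential_decay:
  fixes lam :: "nat \<Rightarrow> real"
  assumes m: "m > 0" and C: "C > 0" and q: "0 < q" "q < 1"
    and le1: "\<And>s. s \<ge> 1 \<Longrightarrow> lam s \<le> lam 1"
    and count: "\<And>n s. s \<ge> 1 \<Longrightarrow> C * q ^ n \<le> lam s \<Longrightarrow> s \<le> 2 * (2 * n + 1) ^ m"
  shows "\<exists>C>0. \<exists>\<alpha>>0. \<forall>s\<ge>1. lam s \<le> C * exp (- \<alpha> * real s powr (1 / real m))"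
proof -
  define a where "a = - ln q"
  have a: "a > 0" using q by (simp add: a_def)
  \<comment> \<open>The exponential factor pays for rounding \<open>n\<close> down, and
    \<open>lam 1\<close> covers the small \<open>s\<close> for which no \<open>n\<close> is
    available.\<close>
  define C' where "C' = (C + \<bar>lam 1\<bar>) * exp (3 * a / 2)"
  define \<alpha> where "\<alpha> = a / 2 * (1/4) powr (1 / real m)"
  have "lam s \<le> C' * exp (- \<alpha> * real s powr (1 / real m))" if s: "s \<ge> 1" for s
  proof -
    \<comment> \<open>The divisor 4 makes \<open>2 * r ^ m\<close> equal to \<open>s / 2\<close>,
      strictly below \<open>s\<close>.\<close>
    define r where "r = (real s / 4) powr (1 / real m)"
    have r: "r > 0" "r ^ m = real s / 4"
      using s m by (auto simp: r_def powr_realpow[symmetric] powr_powr)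
    have \<alpha>r: "\<alpha> * real s powr (1 / real m) = a / 2 * r"
      using powr_mult[of "real s" "1/4" "1 / real m"] by (simp add: \<alpha>_def r_def)
    have "lam s \<le> (C + \<bar>lam 1\<bar>) * exp (- (a * (r - 3) / 2))"
    proof (cases "r < 1")
      case True
      have "lam s \<le> (C + \<bar>lam 1\<bar>) * 1" using le1[OF s] C by simp
      also have "\<dots> \<le> (C + \<bar>lam 1\<bar>) * exp (- (a * (r - 3) / 2))"
        using True a C by (intro mult_left_mono) (auto simp: mult_le_0_iff)
      finally show ?thesis .
    next
      case False
      \<comment> \<open>The largest \<open>n\<close> with \<open>2 * n + 1 \<le> r\<close>;
        consequently \<open>n > (r - 3) / 2\<close>.\<close>
      define n where "n = nat \<lfloor>(r - 1) / 2\<rfloor>"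
      have n: "real n \<le> (r - 1) / 2" "(r - 1) / 2 < real n + 1"
      proof -
        have "real n = of_int \<lfloor>(r - 1) / 2\<rfloor>" using False by (simp add: n_def)
        then show "real n \<le> (r - 1) / 2" "(r - 1) / 2 < real n + 1" by linarith+
      qed
      have "real (2 * (2 * n + 1) ^ m) \<le> 2 * r ^ m"
        using n r by (auto intro!: power_mono)
      also have "\<dots> < real s" using r(2) s by simp
      finally have "2 * (2 * n + 1) ^ m < s" by (simp only: of_nat_less_iff)
      then have "lam s < C * q ^ n" using count[OF s, of n] by (meson not_less)
      also have "q ^ n = exp (- (a * n))"
        using q exp_of_nat_mult[of n "ln q"] by (simp add: a_def mult.commute)
      also have "C * exp (- (a * n)) \<le> (C + \<bar>lam 1\<bar>) * exp (- (a * (r - 3) / 2))"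
      proof (intro mult_mono)
        have "a * ((r - 3) / 2) \<le> a * n" using n a by (intro mult_left_mono) auto
        then show "exp (- (a * n)) \<le> exp (- (a * (r - 3) / 2))" by simp
      qed (use C in auto)
      finally show ?thesis by simp
    qed
    also have "- (a * (r - 3) / 2) = 3 * a / 2 + - (\<alpha> * real s powr (1 / real m))"
      unfolding \<alpha>r by (simp add: field_simps)
    also have "(C + \<bar>lam 1\<bar>) * exp (3 * a / 2 + - (\<alpha> * real s powr (1 / real m))) =
        C' * exp (- \<alpha> * real s powr (1 / real m))"
      by (simp only: exp_add C'_def) simp
    finally show ?thesis .
  qed
  moreover have "C' > 0" "\<alpha> > 0" using a C by (auto simp: C'_def \<alpha>_def intro!: mult_pos_pos add_pos_nonneg)
  ultimately show ?thesis by blast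
qed

lemma stretched_exponential_summable:
  fixes a p :: real
  assumes "a > 0" "p > 0"
  shows "(\<lambda>s::nat. exp (- a * real s powr p)) summable_on UNIV"
proof -
  have "(\<lambda>s::nat. exp (- a * real s powr p)) \<in> O(\<lambda>s. real s powr - 2)"
    using assms by real_asymp
  moreover have "summable (\<lambda>s. norm (real s powr - 2))"
    by (simp add: summable_real_powr_iff)
  ultimately have "summable (\<lambda>s::nat. exp (- a * real s powr p))"
    by (rule summable_comparison_test_bigo[rotated])
  then show ?thesis by (subst summable_on_UNIV_nonneg_real_iff) auto
qed

text \<open>Half of the exponent is spent on the factor in \<open>T\<close> and the other half keeps
  the series convergent. Summability is stated as well because an infinite sum without it has the
  default value 0.\<close>

lemma stretched_exponential_tail_sum:
  fixes lam :: "nat \<Rightarrow> real"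
  assumes C: "C > 0" and \<alpha>: "\<alpha> > 0" and p: "p > 0"
    and lam: "\<And>s. s \<ge> 1 \<Longrightarrow> 0 \<le> lam s" "\<And>s. s \<ge> 1 \<Longrightarrow> lam s \<le> C * exp (- \<alpha> * real s powr p)"
  shows "lam summable_on {1..}"
    and "\<exists>\<beta>>0. eigenvalue_tail_sum lam \<in> O(\<lambda>T. exp (- \<beta> * real T powr p))"
proof -
  have sub: "(\<lambda>s. c * exp (- a * real s powr p)) summable_on A" if "a > 0" for a c A
    using stretched_exponential_summable[OF that p]
    by (intro summable_on_cmult_right) (rule summable_on_subset_banach, auto)
  show s1: "lam summable_on {1..}"
    by (rule summable_on_comparison_test[OF sub[OF \<alpha>]]) (use lam in auto)
  define \<beta> where "\<beta> = \<alpha> / 2"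
  have \<beta>: "\<beta> > 0" using \<alpha> by (simp add: \<beta>_def)
  define g where "g = (\<lambda>s::nat. exp (- \<beta> * real s powr p))"
  have "norm (eigenvalue_tail_sum lam T) \<le> (C * infsum g UNIV) * norm (exp (- \<beta> * real T powr p))" for T
  proof -
    let ?A = "{T + 1..}"
    have sA: "lam summable_on ?A" using s1 by (rule summable_on_subset_banach) auto
    have gs: "g summable_on A" for A using sub[OF \<beta>, of 1] by (simp add: g_def)
    have "infsum lam ?A \<le> (\<Sum>\<^sub>\<infinity>s\<in>?A. C * exp (- \<beta> * real T powr p) * g s)"
    proof (rule infsum_mono[OF sA])
      show "(\<lambda>s. C * exp (- \<beta> * real T powr p) * g s) summable_on ?A"
        using gs by (rule summable_on_cmult_right)
      fix s assume s: "s \<in> ?A"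
      have "real T powr p \<le> real s powr p" using s p by (intro powr_mono2) auto
      then have "\<beta> * real T powr p \<le> \<beta> * real s powr p" using \<beta> by (intro mult_left_mono) auto
      then have "\<beta> * real T powr p + \<beta> * real s powr p \<le> \<alpha> * real s powr p"
        by (simp add: \<beta>_def)
      then have "exp (- \<alpha> * real s powr p) \<le> exp (- \<beta> * real T powr p) * g s"
        by (simp add: g_def exp_add[symmetric])
      then show "lam s \<le> C * exp (- \<beta> * real T powr p) * g s"
        using lam(2)[of s] s C by (auto intro: order_trans simp: mult.assoc)
    qed
    also have "\<dots> = C * exp (- \<beta> * real T powr p) * infsum g ?A"
      by (rule infsum_cmult_right) (rule gs)
    also have "\<dots> \<le> C * exp (- \<beta> * real T powr p) * infsum g UNIV"
      using C gs by (intro mult_left_mono infsum_mono_neutral) (auto simp: g_def)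
    finally have "infsum lam ?A \<le> (C * infsum g UNIV) * exp (- \<beta> * real T powr p)"
      by (simp add: mult_ac)
    moreover have "0 \<le> infsum lam ?A" using lam(1) by (intro infsum_nonneg) auto
    ultimately show ?thesis by (simp add: eigenvalue_tail_sum_def)
  qed
  then have "eigenvalue_tail_sum lam \<in> O(\<lambda>T. exp (- \<beta> * real T powr p))"
    by (intro bigoI always_eventually allI)
  then show "\<exists>\<beta>>0. eigenvalue_tail_sum lam \<in> O(\<lambda>T. exp (- \<beta> * real T powr p))"
    using \<beta> by blast
qed

section \<open>The arcsine kernel\<close>

text \<open>Dividing \<open>(\<sigma>b, \<sigma>v x)\<close> by \<open>w x\<close> gives feature
  vectors to which the power series result applies, with the prefactor of the arcsine absorbed into
  the coefficients.\<close>

lemma nn_kernel_properties: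
  fixes M :: "(real ^ 'm) measure"
  assumes "compact_prob M D"
  shows "compact_prob.psd_kernel M (nn_kernel \<sigma>s \<sigma>v \<sigma>b)"
    and "\<exists>C q. 0 < C \<and> 0 < q \<and> q < 1 \<and>
      (\<forall>n. compact_prob.eigenvalue_count_le M (nn_kernel \<sigma>s \<sigma>v \<sigma>b) (C * q ^ n) (2 * (2 * n + 1) ^ CARD('m)))"
proof -
  interpret compact_prob M D by fact
  obtain c :: "nat \<Rightarrow> real" where c: "\<And>d. c d \<ge> 0"
    "\<And>t. \<bar>t\<bar> < 1 \<Longrightarrow> (\<lambda>d. c d * t ^ d) sums arcsin t"
    using arcsin_power_series by blast
  define A where "A = 2 * \<sigma>s\<^sup>2 / pi"
  define w where "w = (\<lambda>x :: real ^ 'm. sqrt (1 + \<sigma>v\<^sup>2 * (x \<bullet> x) + \<sigma>b\<^sup>2))"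
  define u\<^sub>0 where "u\<^sub>0 = (\<lambda>x. \<sigma>b / w x)"
  define u where "u = (\<lambda>i x. \<sigma>v * x $ i / w x)"
  have pos: "1 + \<sigma>v\<^sup>2 * (x \<bullet> x) + \<sigma>b\<^sup>2 > 0" for x :: "real ^ 'm"
    by (intro add_pos_nonneg) auto
  have w: "w x > 0" "(w x)\<^sup>2 = 1 + \<sigma>v\<^sup>2 * (x \<bullet> x) + \<sigma>b\<^sup>2" for x
    using pos[of x] by (auto simp: w_def)
  have cw: "continuous_on UNIV w" unfolding w_def by (intro continuous_intros)
  have T: "u\<^sub>0 x * u\<^sub>0 y + (\<Sum>i\<in>UNIV. u i x * u i y) = (\<sigma>v\<^sup>2 * (x \<bullet> y) + \<sigma>b\<^sup>2) / (w x * w y)" for x y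
    by (simp add: u\<^sub>0_def u_def inner_vec_def sum_distrib_left sum_divide_distrib add_divide_distrib
        power2_eq_square mult_ac)
  \<comment> \<open>Both \<open>(u\<^sub>0 x)\<^sup>2\<close> and
    \<open>1 - (\<Sum>i\<in>UNIV. (u i x)\<^sup>2)\<close> are constants divided by
    \<open>(w x)\<^sup>2\<close>, namely \<open>\<sigma>b\<^sup>2\<close> and
    \<open>1 + \<sigma>b\<^sup>2\<close>; the quotient of these is the constant of the
    quadric.\<close>
  have quad: "(u\<^sub>0 x)\<^sup>2 = \<sigma>b\<^sup>2 / (1 + \<sigma>b\<^sup>2) * (1 - (\<Sum>i\<in>UNIV. (u i x)\<^sup>2))" for x
  proof -
    have "(\<Sum>i\<in>UNIV. (u i x)\<^sup>2) = \<sigma>v\<^sup>2 * (x \<bullet> x) / (w x)\<^sup>2"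
      by (simp add: u_def inner_vec_def power_divide power_mult_distrib power2_eq_square
          sum_distrib_left sum_divide_distrib mult_ac)
    also have "\<dots> = 1 - (1 + \<sigma>b\<^sup>2) / (w x)\<^sup>2"
      using w(1)[of x] by (simp add: w(2)[of x, symmetric] field_simps) (simp add: w(2))
    finally have "1 - (\<Sum>i\<in>UNIV. (u i x)\<^sup>2) = (1 + \<sigma>b\<^sup>2) / (w x)\<^sup>2" by simp
    moreover have "1 + \<sigma>b\<^sup>2 \<noteq> 0" using zero_le_power2[of \<sigma>b] by linarith
    ultimately show ?thesis by (simp add: u\<^sub>0_def power_divide)
  qed
  \<comment> \<open>The summand 1 inside \<open>w\<close> makes the norm of each unscaled vector
    strictly smaller than \<open>w\<close>, so Cauchy-Schwarz gives a strict bound even at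
    \<open>x = y\<close>.\<close>
  have T1: "\<bar>u\<^sub>0 x * u\<^sub>0 y + (\<Sum>i\<in>UNIV. u i x * u i y)\<bar> < 1" for x y
  proof -
    define X where "X = (\<sigma>v *\<^sub>R x, \<sigma>b)"
    define Y where "Y = (\<sigma>v *\<^sub>R y, \<sigma>b)"
    have XY: "\<sigma>v\<^sup>2 * (x \<bullet> y) + \<sigma>b\<^sup>2 = X \<bullet> Y" by (simp add: X_def Y_def power2_eq_square)
    have "norm X < w x"
      unfolding w_def norm_eq_sqrt_inner by (rule real_sqrt_less_mono) (simp add: X_def power2_eq_square)
    moreover have "norm Y < w y"
      unfolding w_def norm_eq_sqrt_inner by (rule real_sqrt_less_mono) (simp add: Y_def power2_eq_square)
    ultimately have "norm X * norm Y < w x * w y" by (intro mult_strict_mono') auto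
    then have "\<bar>X \<bullet> Y\<bar> < w x * w y" using Cauchy_Schwarz_ineq2[of X Y] by linarith
    then show ?thesis unfolding T XY using w(1)[of x] w(1)[of y] by (simp add: abs_mult)
  qed
  have K: "nn_kernel \<sigma>s \<sigma>v \<sigma>b = (\<lambda>x y. A * arcsin (u\<^sub>0 x * u\<^sub>0 y + (\<Sum>i\<in>UNIV. u i x * u i y)))"
    unfolding T by (simp add: nn_kernel_def w_def A_def real_sqrt_mult fun_eq_iff)
  have cu: "continuous_on UNIV u\<^sub>0" "continuous_on UNIV (u i)" for i
    unfolding u\<^sub>0_def u_def using w(1) by (intro continuous_intros cw; metis less_irrefl)+
  have A: "A * c d \<ge> 0" for d using c by (simp add: A_def)
  have Ac: "(\<lambda>d. (A * c d) * t ^ d) sums (A * arcsin t)" if "\<bar>t\<bar> < 1" for t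
    using sums_mult[OF c(2)[OF that], of A] by (simp add: mult.assoc)
  note psk = power_series_kernel[where c = "\<lambda>d. A * c d" and F = "\<lambda>t. A * arcsin t" and u = u,
      OF A Ac cu quad T1]
  show "psd_kernel (nn_kernel \<sigma>s \<sigma>v \<sigma>b)"
    unfolding K by (rule psk(1))
  show "\<exists>C q. 0 < C \<and> 0 < q \<and> q < 1 \<and>
      (\<forall>n. eigenvalue_count_le (nn_kernel \<sigma>s \<sigma>v \<sigma>b) (C * q ^ n) (2 * (2 * n + 1) ^ CARD('m)))"
    unfolding K by (rule psk(2))
qed

text \<open>The existence claim keeps the statement about all listings from being vacuous, and
  summability keeps the tail sum from being a default value.\<close>

theorem proposition4p4:
  fixes \<sigma>s \<sigma>v \<sigma>b :: real
    and k :: "real ^ 'm \<Rightarrow> real ^ 'm \<Rightarrow> real"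
    and M :: "(real ^ 'm) measure"
  assumes "\<sigma>s > 0" and "\<sigma>v > 0" and "\<sigma>b > 0"
    and k: "k = nn_kernel \<sigma>s \<sigma>v \<sigma>b"
    and M: "M = uniform_measure lborel unit_cube"
  shows "(\<exists>lam. eigenvalue_listing M k lam) \<and>
    (\<forall>lam. eigenvalue_listing M k lam \<longrightarrow>
      (\<exists>C>0. \<exists>\<alpha>>0. \<forall>s\<ge>1. lam s \<le> C * exp (- \<alpha> * real s powr (1 / real CARD('m)))) \<and>
      lam summable_on {1..} \<and>
      (\<exists>\<beta>>0. eigenvalue_tail_sum lam \<in> O(\<lambda>T. exp (- \<beta> * real T powr (1 / real CARD('m))))))"
proof -
  have cube: "(unit_cube :: (real ^ 'm) set) = cbox 0 1"
    by (auto simp: unit_cube_def cbox_def Basis_vec_def inner_axis)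
  \<comment> \<open>Volume 1 makes the uniform measure on the cube a probability measure.\<close>
  have em: "emeasure lborel (unit_cube :: (real ^ 'm) set) = 1"
    unfolding cube by (simp add: emeasure_lborel_cbox_eq Basis_vec_def inner_axis axis_eq_axis prod.UNION_disjoint)
  interpret compact_prob M unit_cube
  proof -
    interpret prob_space M unfolding M by (rule prob_space_uniform_measure) (simp_all add: em)
    show "compact_prob M unit_cube"
    proof
      show "compact (unit_cube :: (real ^ 'm) set)" by (simp add: cube)
      show "sets M = sets borel" by (simp add: M)
      show "AE x in M. x \<in> unit_cube"
        unfolding M by (rule AE_uniform_measureI) (auto simp: cube)
    qed
  qed
  have psd: "psd_kernel k"
    unfolding k using compact_prob_axioms by (rule nn_kernel_properties(1))
  obtain C q where C: "0 < C" and q: "0 < q" "q < 1"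
    and count: "\<And>n. eigenvalue_count_le k (C * q ^ n) (2 * (2 * n + 1) ^ CARD('m))"
    using nn_kernel_properties(2)[OF compact_prob_axioms] unfolding k by metis
  have ck: "continuous_kernel k" and sym: "\<And>x y. k x y = k y x"
    using psd by (auto simp: psd_kernel_def)
  have "\<exists>lam. eigenvalue_listing M k lam"
    using psd
  proof (rule eigenvalue_listing_exists)
    fix l :: real assume l: "l > 0"
    \<comment> \<open>A count at a level below \<open>l\<close> also bounds the count at
      \<open>l\<close>, and the levels \<open>C * q ^ n\<close> become arbitrarily small.\<close>
    obtain n where "q ^ n < l / C" using real_arch_pow_inv[of "l / C" q] l C q by auto
    then have "C * q ^ n \<le> l" using C by (simp add: field_simps)
    then have "eigenvalue_count_le k l (2 * (2 * n + 1) ^ CARD('m))"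
      using count[of n] unfolding eigenvalue_count_le_def by (meson order_trans)
    then show "\<exists>N. eigenvalue_count_le k l N" ..
  qed
  moreover have "(\<exists>C>0. \<exists>\<alpha>>0. \<forall>s\<ge>1. lam s \<le> C * exp (- \<alpha> * real s powr (1 / real CARD('m)))) \<and>
      lam summable_on {1..} \<and>
      (\<exists>\<beta>>0. eigenvalue_tail_sum lam \<in> O(\<lambda>T. exp (- \<beta> * real T powr (1 / real CARD('m)))))"
    if lam: "eigenvalue_listing M k lam" for lam
  proof -
    have lam0: "0 \<le> lam s" and dec: "lam (Suc s) \<le> lam s" if "s \<ge> 1" for s
      using lam that by (auto simp: eigenvalue_listing_def)
    have le1: "lam s \<le> lam 1" if "s \<ge> 1" for s
      using that
    proof (induction rule: dec_induct)
      case (step n)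
      then show ?case using dec[of n] by simp
    qed simp
    have "\<exists>C>0. \<exists>\<alpha>>0. \<forall>s\<ge>1. lam s \<le> C * exp (- \<alpha> * real s powr (1 / real CARD('m)))"
      using _ C q le1
    proof (rule stretched_exponential_decay)
      fix n s assume "s \<ge> 1" "C * q ^ n \<le> lam s"
      then show "s \<le> 2 * (2 * n + 1) ^ CARD('m)"
        using eigenvalue_listing_count[OF ck sym lam count] C q by simp
    qed simp
    moreover from this obtain C \<alpha> where "C > 0" "\<alpha> > 0"
      "\<And>s. s \<ge> 1 \<Longrightarrow> lam s \<le> C * exp (- \<alpha> * real s powr (1 / real CARD('m)))" by blast
    note stretched_exponential_tail_sum[OF this(1,2) _ lam0 this(3)]
    ultimately show ?thesis by simp
  qed
  ultimately show ?thesis by blast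
qed

end
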